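(* Let $m>1$, $p\in(0,1)$ with $m+p=2$, and let $\sigma>2$. Let $\alpha=\frac{\sigma+2}{(\sigma-2)(m-1)}$, $\beta=\frac{2}{\sigma-2}$ and $$\xi_{max}=\left(\frac{\beta^2}{4m}\right)^{1/(\sigma-2)}=\left(\frac{1}{m(\sigma-2)^2}\right)^{1/(\sigma-2)}\in(0,\infty).$$ Then for any $\xi_0\in(0,\xi_{max}]$ there exists at least one good profile with interface $f(\xi)$ having its interface point exactly at $\xi=\xi_0$. For any $\xi_0\in(\xi_{max},\infty)$ there is no good profile with interface exactly at $\xi_0$.
   Context: The equation is $u_t=(u^m)_{xx}+|x|^{\sigma}u^p$, $(x,t)\in\mathbb{R}\times(0,T)$. Self-similar blow-up solutions have the form $u(x,t)=(T-t)^{-\alpha}f(\xi)$, $\xi=|x|(T-t)^{\beta}$, with $\alpha=\frac{\sigma+2}{(\sigma-2)(m-1)}$ and $\beta=\frac{2}{\sigma-2}$, and the (nonnegative) profile $f$ solves $$(f^m)''(\xi)-\alpha f(\xi)+\beta\xi f'(\xi)+\xi^{\sigma}f^{2-m}(\xi)=0,\qquad \xi\in[0,\infty).\qquad( * )$$ A solution $f$ of $( * )$ is a good profile if it satisfies one of: (P1) $f(0)=a>0$, $f'(0)=0$; (P2) $f(0)=0$, $(f^m)'(0)=0$. A profile $f$ has an interface at $\xi_0\in(0,\infty)$ if $f(\xi_0)=0$, $(f^m)'(\xi_0)=0$ and $f>0$ on $(\xi_0-\delta,\xi_0)$ for some $\delta>0$. A good profile with interface is a good profile having an interface at some point $\xi_0\in(0,\infty)$.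 *)

theory Defs
  imports Complex_Main
begin

definition ss_alpha :: "real \<Rightarrow> real \<Rightarrow> real" where
  "ss_alpha m \<sigma> = (\<sigma> + 2) / ((\<sigma> - 2) * (m - 1))"

definition ss_beta :: "real \<Rightarrow> real" where
  "ss_beta \<sigma> = 2 / (\<sigma> - 2)"

definition xi_max :: "real \<Rightarrow> real \<Rightarrow> real" where
  "xi_max m \<sigma> = ((ss_beta \<sigma>)\<^sup>2 / (4 * m)) powr (1 / (\<sigma> - 2))"

text \<open>
  Classical nonnegative solutions of
  \<open>(f^m)'' - \<alpha> f + \<beta> \<xi> f' + \<xi>^\<sigma> f^(2-m) = 0\<close> on \<open>[0,\<infinity>)\<close>.
  All derivatives are relative to \<open>[0,\<infinity>)\<close>, so they are one-sided at the origin, and the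
  values of \<open>f\<close> at negative arguments are irrelevant. Here \<open>f1\<close> is \<open>f'\<close>, while \<open>g1\<close> and
  \<open>g2\<close> are \<open>(f^m)'\<close> and \<open>(f^m)''\<close>. In the range \<open>1 < m < 2\<close> the equation makes sense
  pointwise also where \<open>f\<close> vanishes (\<open>0 powr (2 - m) = 0\<close> agrees with the usual
  convention), so a profile may vanish identically beyond its interface point.
\<close>
definition profile_solution :: "real \<Rightarrow> real \<Rightarrow> (real \<Rightarrow> real) \<Rightarrow> bool" where
  "profile_solution m \<sigma> f \<longleftrightarrow>
     (\<forall>\<xi>\<ge>0. f \<xi> \<ge> 0) \<and>
     (\<exists>f1 g1 g2. \<forall>\<xi>\<ge>0.
        (f has_real_derivative f1 \<xi>) (at \<xi> within {0..}) \<and>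
        ((\<lambda>x. f x powr m) has_real_derivative g1 \<xi>) (at \<xi> within {0..}) \<and>
        (g1 has_real_derivative g2 \<xi>) (at \<xi> within {0..}) \<and>
        g2 \<xi> - ss_alpha m \<sigma> * f \<xi> + ss_beta \<sigma> * \<xi> * f1 \<xi>
          + \<xi> powr \<sigma> * f \<xi> powr (2 - m) = 0)"

definition good_profile :: "real \<Rightarrow> real \<Rightarrow> (real \<Rightarrow> real) \<Rightarrow> bool" where
  "good_profile m \<sigma> f \<longleftrightarrow>
     profile_solution m \<sigma> f \<and>
     ((f 0 > 0 \<and> (f has_real_derivative 0) (at 0 within {0..})) \<or>
      (f 0 = 0 \<and> ((\<lambda>x. f x powr m) has_real_derivative 0) (at 0 within {0..})))"

definition has_interface_at :: "real \<Rightarrow> (real \<Rightarrow> real) \<Rightarrow> real \<Rightarrow> bool" where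
  "has_interface_at m f \<xi>0 \<longleftrightarrow>
     0 < \<xi>0 \<and> f \<xi>0 = 0 \<and>
     ((\<lambda>x. f x powr m) has_real_derivative 0) (at \<xi>0) \<and>
     (\<exists>\<delta>>0. \<forall>\<xi>\<in>{\<xi>0 - \<delta><..<\<xi>0}. f \<xi> > 0)"

end

theory Submission
  imports Defs "HOL-Complex_Analysis.Great_Picard"
begin

text \<open>
  With \<open>v = f^(m-1)\<close> and \<open>n = 1/(m-1)\<close>, the case \<open>m + p = 2\<close> is the one where the profile equation
  is, up to a power of \<open>v\<close>, the equation
  \<open>(n+1) v v'' + n(n+1) v'\<^sup>2 - \<alpha> v + \<beta> n \<xi> v' + \<xi>^\<sigma> = 0\<close>. At an interface the slope \<open>w = v'\<close>
  is therefore a root of \<open>n(n+1) w\<^sup>2 + \<beta> n \<xi> w + \<xi>^\<sigma>\<close>, which has real roots exactly for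
  \<open>\<xi> \<le> xi_max\<close>.

  Beyond \<open>xi_max\<close> the quadratic is bounded below by a positive constant. Near an interface the flux
  \<open>(f^m)' + \<beta> \<xi> f\<close> is decreasing to \<open>0\<close>, which bounds \<open>v'\<close> from below, so
  \<open>v \<le> L (\<xi>0 - \<xi>)\<close> and \<open>v'' \<le> - K / (\<xi>0 - \<xi>)\<close>; integrating, \<open>v'\<close> tends to
  \<open>-\<infinity>\<close>, a contradiction.

  For \<open>\<xi>0 \<le> xi_max\<close> the parabola \<open>\<beta> (\<xi>0\<^sup>2 - \<xi>\<^sup>2) / (4(n+1))\<close> is a supersolution on
  \<open>(0, \<xi>0)\<close> and \<open>\<theta> \<xi>^\<sigma> (\<xi>0 - \<xi>)\<close> is a subsolution for small \<open>\<theta>\<close>. Between them lies a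
  solution with \<open>(f^m)'(0) = 0\<close> and \<open>f(\<xi>0) = 0\<close>; it satisfies (P1) or (P2) according to whether
  \<open>f(0)\<close> is positive, and the supersolution makes it flat enough at \<open>\<xi>0\<close> to be an interface.
\<close>

section \<open>A shooting form of Peano's theorem\<close>

text \<open>The substitution \<open>t = x * \<tau>\<close> moves the variable end point into an
  integrand over the fixed compact interval \<open>[0, 1]\<close>, where continuity of integrals in
  a parameter applies.\<close>

lemma continuous_on_indefinite_integral_param:
  fixes f :: "'p::topological_space \<Rightarrow> real \<Rightarrow> 'a::euclidean_space"
  assumes f: "continuous_on (UNIV \<times> {0..b}) (\<lambda>(s, t). f s t)"
  shows "continuous_on (UNIV \<times> {0..b}) (\<lambda>(s, x). integral {0..x} (f s))"
proof -
  have eq: "integral {0..x} (f s) = x *\<^sub>R integral (cbox 0 1) (\<lambda>\<tau>. f s (x * \<tau>))"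
    if "x \<in> {0..b}" for s x
  proof (cases "x = 0")
    case False
    then have x: "x > 0" using that by auto
    have "continuous_on {0..x} (\<lambda>t. (\<lambda>(s, t). f s t) (s, t))"
      by (rule continuous_on_compose2[OF f]) (use that in \<open>auto intro!: continuous_intros\<close>)
    then have "f s integrable_on {0..x}"
      by (simp add: integrable_continuous_real)
    then have "(f s has_integral integral {0..x} (f s)) {0..x}" by blast
    from has_integral_stretch_real[OF this, of x] x
    have "((\<lambda>\<tau>. f s (x * \<tau>)) has_integral (1 / x) *\<^sub>R integral {0..x} (f s)) ((\<lambda>t. t / x) ` {0..x})"
      by simp
    moreover have "(\<lambda>t. t / x) ` {0..x} = {0..1}"
      using x by (simp add: image_divide_atLeastAtMost)
    ultimately have "integral (cbox 0 1) (\<lambda>\<tau>. f s (x * \<tau>)) = (1 / x) *\<^sub>R integral {0..x} (f s)"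
      by (simp add: integral_unique)
    then show ?thesis using x by simp
  qed simp
  have "continuous_on ((UNIV \<times> {0..b}) \<times> cbox 0 1) (\<lambda>(sx, \<tau>). f (fst sx) (snd sx * \<tau>))"
  proof -
    have "continuous_on ((UNIV \<times> {0..b}) \<times> cbox 0 1)
        (\<lambda>z. (\<lambda>(s, t). f s t) (fst (fst z), snd (fst z) * snd z))"
    proof (rule continuous_on_compose2[OF f])
      show "(\<lambda>z. (fst (fst z), snd (fst z) * snd z)) ` ((UNIV \<times> {0..b}) \<times> cbox 0 (1::real))
          \<subseteq> UNIV \<times> {0..b}"
        by (auto intro: order_trans[OF mult_left_le])
    qed (intro continuous_intros)
    then show ?thesis by (simp add: case_prod_unfold)
  qed
  then have "continuous_on (UNIV \<times> {0..b})
      (\<lambda>sx. integral (cbox 0 1) (\<lambda>\<tau>. f (fst sx) (snd sx * \<tau>)))"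
    by (rule integral_continuous_on_param)
  then have "continuous_on (UNIV \<times> {0..b})
      (\<lambda>sx. snd sx *\<^sub>R integral (cbox 0 1) (\<lambda>\<tau>. f (fst sx) (snd sx * \<tau>)))"
    by (intro continuous_intros)
  then show ?thesis
    by (rule continuous_on_cong[THEN iffD1, rotated 2]) (auto simp: eq)
qed

text \<open>Method of steps: the integrand at time \<open>t\<close> uses the solution only at
  \<open>max 0 (t - h)\<close>, so each application of the integral operator fixes the solution on a
  further interval of length \<open>h\<close>. Finitely many applications cover
  \<open>[0, b]\<close>, and each preserves joint continuity in \<open>(s, x)\<close>.\<close>

lemma delayed_integral_equation:
  fixes F :: "real \<Rightarrow> 'a::euclidean_space \<Rightarrow> 'a" and u0 :: "'p::topological_space \<Rightarrow> 'a"
  assumes b: "0 \<le> b" and h: "0 < h"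
    and F: "continuous_on ({0..b} \<times> UNIV) (\<lambda>(t, u). F t u)"
    and u0: "continuous_on UNIV u0"
  obtains U where "continuous_on (UNIV \<times> {0..b}) (\<lambda>(s, x). U s x)"
    "\<And>s x. x \<in> {0..b} \<Longrightarrow> U s x = u0 s + integral {0..x} (\<lambda>t. F t (U s (max 0 (t - h))))"
proof -
  define step where "step V s x = u0 s + integral {0..x} (\<lambda>t. F t (V s (max 0 (t - h))))"
    for V s x
  define A where "A j = (step ^^ j) (\<lambda>s x. u0 s)" for j
  have A_Suc: "A (Suc j) s x = u0 s + integral {0..x} (\<lambda>t. F t (A j s (max 0 (t - h))))" for j s x
    by (simp add: A_def step_def)
  have cont: "continuous_on (UNIV \<times> {0..b}) (\<lambda>(s, x). A j s x)" for j
  proof (induction j)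
    case 0
    show ?case
      unfolding A_def case_prod_unfold
      by (auto intro!: continuous_on_compose2[OF u0] continuous_intros)
  next
    case (Suc j)
    have 1: "continuous_on (UNIV \<times> {0..b})
        (\<lambda>z. (\<lambda>(s, x). A j s x) (fst z, max 0 (snd z - h)))"
      by (rule continuous_on_compose2[OF Suc]) (use h b in \<open>auto intro!: continuous_intros\<close>)
    have "continuous_on (UNIV \<times> {0..b})
        (\<lambda>z. (\<lambda>(t, u). F t u) (snd z, A j (fst z) (max 0 (snd z - h))))"
      using 1 by (intro continuous_on_compose2[OF F]) (auto intro!: continuous_intros)
    then have "continuous_on (UNIV \<times> {0..b}) (\<lambda>(s, t). F t (A j s (max 0 (t - h))))"
      by (simp add: case_prod_unfold)
    from continuous_on_indefinite_integral_param[OF this]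
    have 2: "continuous_on (UNIV \<times> {0..b})
        (\<lambda>z. integral {0..snd z} (\<lambda>t. F t (A j (fst z) (max 0 (t - h)))))"
      by (simp add: case_prod_unfold)
    have 3: "continuous_on (UNIV \<times> {0..b}) (\<lambda>z::'p \<times> real. u0 (fst z))"
      by (auto intro!: continuous_on_compose2[OF u0] continuous_intros)
    show ?case
      using continuous_on_add[OF 3 2] by (simp add: A_Suc case_prod_unfold)
  qed
  \<comment> \<open>For \<open>t\<close> up to \<open>(j + 1) * h\<close> the delayed time is at
    most \<open>j * h\<close>, where successive iterates already agree. The base case concerns
    \<open>x = 0\<close> only, where both iterates equal \<open>u0 s\<close>.\<close>
  have stable: "A (Suc j) s x = A j s x" if "0 \<le> x" "x \<le> real j * h" for j s x
    using that
  proof (induction j arbitrary: x)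
    case 0
    then show ?case by (simp add: A_Suc) (simp add: A_def)
  next
    case (Suc j)
    have "integral {0..x} (\<lambda>t. F t (A (Suc j) s (max 0 (t - h))))
        = integral {0..x} (\<lambda>t. F t (A j s (max 0 (t - h))))"
    proof (rule integral_cong)
      fix t assume "t \<in> {0..x}"
      then have "0 \<le> max 0 (t - h)" "max 0 (t - h) \<le> real j * h"
        using Suc.prems h by (auto simp: algebra_simps)
      then show "F t (A (Suc j) s (max 0 (t - h))) = F t (A j s (max 0 (t - h)))"
        using Suc.IH by simp
    qed
    then show ?case by (simp only: A_Suc[of "Suc j"] A_Suc[of j])
  qed
  obtain N :: nat where N: "b \<le> real N * h"
    using reals_Archimedean3[OF h] by (meson less_imp_le)
  show ?thesis
  proof (rule that[OF cont[of N]])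
    fix s x assume "x \<in> {0..b}"
    then have "A (Suc N) s x = A N s x" using stable N by force
    then show "A N s x = u0 s + integral {0..x} (\<lambda>t. F t (A N s (max 0 (t - h))))"
      by (simp add: A_Suc)
  qed
qed

text \<open>Peano's theorem with a shooting parameter. Delaying the argument of the right-hand side makes
  the solution operator explicit, hence continuous in the parameter although the limiting problem
  has no uniqueness; the intermediate value theorem fixes the parameter before the delay is
  removed.\<close>

lemma peano_shooting:
  fixes F :: "real \<Rightarrow> 'a::euclidean_space \<Rightarrow> 'a" and u0 :: "real \<Rightarrow> 'a" and l :: "'a \<Rightarrow> real"
  assumes b: "0 < b"
    and F: "continuous_on ({0..b} \<times> UNIV) (\<lambda>(t, u). F t u)"
    and F_bound: "\<And>t u. t \<in> {0..b} \<Longrightarrow> norm (F t u) \<le> C"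
    and u0: "continuous_on UNIV u0" and l: "continuous_on UNIV l"
    and s12: "s1 \<le> s2"
    and low: "\<And>w. norm w \<le> C * b \<Longrightarrow> l (u0 s1 + w) \<le> c"
    and high: "\<And>w. norm w \<le> C * b \<Longrightarrow> c \<le> l (u0 s2 + w)"
  obtains s u where "s \<in> {s1..s2}" "u 0 = u0 s" "l (u b) = c"
    "\<And>x. x \<in> {0..b} \<Longrightarrow> (u has_vector_derivative F x (u x)) (at x within {0..b})"
proof -
  define h where "h k = 1 / real (Suc k)" for k
  have h_pos: "h k > 0" for k by (simp add: h_def)
  have h_lim: "h \<longlonglongrightarrow> 0"
    unfolding h_def by (rule LIMSEQ_Suc[OF lim_1_over_n])
  have "\<forall>k. \<exists>U. continuous_on (UNIV \<times> {0..b}) (\<lambda>(s, x). U s x) \<and>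
    (\<forall>s. \<forall>x\<in>{0..b}. U s x = u0 s + integral {0..x} (\<lambda>t. F t (U s (max 0 (t - h k)))))"
    using delayed_integral_equation[OF less_imp_le[OF b] h_pos F u0] by metis
  then obtain U where U_cont: "\<And>k. continuous_on (UNIV \<times> {0..b}) (\<lambda>(s, x). U k s x)"
    and U_eq: "\<And>k s x. x \<in> {0..b} \<Longrightarrow>
      U k s x = u0 s + integral {0..x} (\<lambda>t. F t (U k s (max 0 (t - h k))))"
    by metis
  have U_contx: "continuous_on {0..b} (U k s)" for k s
  proof -
    have "continuous_on {0..b} (\<lambda>x. (\<lambda>(s, x). U k s x) (s, x))"
      by (rule continuous_on_compose2[OF U_cont[of k]]) (auto intro!: continuous_intros)
    then show ?thesis by simp
  qed
  have U_conts: "continuous_on UNIV (\<lambda>s. U k s x)" if "x \<in> {0..b}" for k x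
  proof -
    have "continuous_on UNIV (\<lambda>s. (\<lambda>(s, x). U k s x) (s, x))"
      by (rule continuous_on_compose2[OF U_cont[of k]]) (use that in \<open>auto intro!: continuous_intros\<close>)
    then show ?thesis by simp
  qed
  have G_cont: "continuous_on {0..b} (\<lambda>t. F t (U k s (max 0 (t - h k))))" for k s
  proof -
    have 1: "continuous_on {0..b} (\<lambda>t. U k s (max 0 (t - h k)))"
      by (rule continuous_on_compose2[OF U_contx[of k s]])
        (use h_pos[of k] b in \<open>auto intro!: continuous_intros\<close>)
    have "continuous_on {0..b} (\<lambda>t. (\<lambda>(t, u). F t u) (t, U k s (max 0 (t - h k))))"
      using 1 by (intro continuous_on_compose2[OF F]) (auto intro!: continuous_intros)
    then show ?thesis by simp
  qed
  have C: "0 \<le> C"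
    by (rule order_trans[OF norm_ge_zero F_bound[of 0 undefined]]) (use b in simp)
  \<comment> \<open>The Lipschitz constant is uniform in \<open>k\<close> and \<open>s\<close>. It
    confines the end value for the intermediate value theorem, gives equicontinuity, and later
    controls the error caused by the delay.\<close>
  have U_lip: "norm (U k s x - U k s y) \<le> C * \<bar>x - y\<bar>" if "x \<in> {0..b}" "y \<in> {0..b}" for k s x y
  proof -
    have *: "norm (U k s x - U k s y) \<le> C * (x - y)" if "x \<in> {0..b}" "y \<in> {0..b}" "y \<le> x" for x y
    proof -
      let ?g = "\<lambda>t. F t (U k s (max 0 (t - h k)))"
      have int: "?g integrable_on {0..x}"
        by (rule integrable_continuous_real)
          (use continuous_on_subset[OF G_cont[of k s], of "{0..x}"] that in auto)
      have "integral {0..y} ?g + integral {y..x} ?g = integral {0..x} ?g"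
        by (rule Henstock_Kurzweil_Integration.integral_combine) (use that int in auto)
      then have "U k s x - U k s y = integral {y..x} ?g"
        using that by (simp add: U_eq[of x k s] U_eq[of y k s]) (metis add_diff_cancel_left')
      moreover have "norm (integral {y..x} ?g) \<le> C * (x - y)"
        by (rule integral_bound)
          (use that F_bound continuous_on_subset[OF G_cont[of k s], of "{y..x}"] in auto)
      ultimately show ?thesis by simp
    qed
    show ?thesis
      using *[of x y] *[of y x] that by (cases "y \<le> x") (auto simp: norm_minus_commute abs_if)
  qed
  have U_0: "U k s 0 = u0 s" for k s using U_eq[of 0 k s] b by simp
  have U_near: "norm (U k s x - u0 s) \<le> C * b" if "x \<in> {0..b}" for k s x
  proof -
    have "norm (U k s x - u0 s) \<le> C * \<bar>x - 0\<bar>" using U_lip[OF that, of 0 k s] b by (simp add: U_0)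
    also have "\<dots> \<le> C * b" using that C by (intro mult_left_mono) auto
    finally show ?thesis .
  qed
  \<comment> \<open>Every delayed solution ends within \<open>C * b\<close> of its initial value, so
    \<open>low\<close> and \<open>high\<close> apply at the two ends of the parameter
    interval.\<close>
  have "\<exists>s\<in>{s1..s2}. l (U k s b) = c" for k
  proof -
    have "continuous_on {s1..s2} (\<lambda>s. l (U k s b))"
      by (rule continuous_on_compose2[OF l], rule continuous_on_subset[OF U_conts]) (use b in auto)
    moreover have "l (U k s1 b) \<le> c" "c \<le> l (U k s2 b)"
      using low[of "U k s1 b - u0 s1"] high[of "U k s2 b - u0 s2"] U_near b by auto
    ultimately show ?thesis using IVT'[of "\<lambda>s. l (U k s b)" s1 c s2] s12 by auto
  qed
  then obtain S where S: "\<And>k. S k \<in> {s1..s2}" and S_l: "\<And>k. l (U k (S k) b) = c" by metis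
  \<comment> \<open>Two successive extractions: first the shooting parameters converge by
    compactness, then the corresponding solutions converge uniformly by Arzela-Ascoli.\<close>
  have "compact {s1..s2}" by simp
  then obtain s r1 where s: "s \<in> {s1..s2}" and r1: "strict_mono r1" and Slim: "(S \<circ> r1) \<longlonglongrightarrow> s"
    using S unfolding compact_def by meson
  have "compact (u0 ` {s1..s2})"
    by (intro compact_continuous_image continuous_on_subset[OF u0]) auto
  then obtain B where B: "\<And>t. t \<in> {s1..s2} \<Longrightarrow> norm (u0 t) \<le> B"
    by (meson bounded_iff compact_imp_bounded image_eqI)
  define V where "V k = U (r1 k) (S (r1 k))" for k
  obtain u r2 where u_cont: "continuous_on {0..b} u" and r2: "strict_mono (r2 :: nat \<Rightarrow> nat)"
    and u_lim: "\<And>e. 0 < e \<Longrightarrow> \<exists>N. \<forall>n x. n \<ge> N \<and> x \<in> {0..b} \<longrightarrow> norm (V (r2 n) x - u x) < e"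
  proof (rule Arzela_Ascoli[of "{0..b}" V "B + C * b"])
    show "norm (V n x) \<le> B + C * b" if "x \<in> {0..b}" for n x
      using U_near[OF that, of "r1 n" "S (r1 n)"] B[OF S, of "r1 n"]
        norm_triangle_sub[of "V n x" "u0 (S (r1 n))"] unfolding V_def by linarith
    show "\<exists>d>0. \<forall>n y. y \<in> {0..b} \<and> norm (x - y) < d \<longrightarrow> norm (V n x - V n y) < e"
      if "x \<in> {0..b}" "0 < e" for x e
    \<comment> \<open>The divisor \<open>C + 1\<close> covers the case \<open>C = 0\<close>.\<close>
    proof (intro exI[of _ "e / (C + 1)"] conjI allI impI)
      show "e / (C + 1) > 0" using that C by simp
      fix n y assume y: "y \<in> {0..b} \<and> norm (x - y) < e / (C + 1)"
      have "norm (V n x - V n y) \<le> C * \<bar>x - y\<bar>" unfolding V_def using U_lip that y by blast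
      also have "\<dots> \<le> (C + 1) * \<bar>x - y\<bar>" by (simp add: mult_right_mono)
      also have "\<dots> < e" using y C by (simp add: pos_less_divide_eq mult.commute)
      finally show "norm (V n x - V n y) < e" .
    qed
  qed auto
  define r where "r k = r1 (r2 k)" for k
  have r: "strict_mono r" unfolding r_def using r1 r2 by (simp add: strict_mono_def)
  have u_pt: "(\<lambda>k. U (r k) (S (r k)) x) \<longlonglongrightarrow> u x" if "x \<in> {0..b}" for x
    unfolding LIMSEQ_iff using u_lim that unfolding V_def r_def by meson
  have S_lim: "(\<lambda>k. S (r k)) \<longlonglongrightarrow> s"
    using LIMSEQ_subseq_LIMSEQ[OF Slim r2] by (simp add: r_def o_def)
  have hr: "(\<lambda>k. h (r k)) \<longlonglongrightarrow> 0"
    using LIMSEQ_subseq_LIMSEQ[OF h_lim r] by (simp add: o_def)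
  have u0_lim: "(\<lambda>k. u0 (S (r k))) \<longlonglongrightarrow> u0 s"
    by (rule continuous_on_tendsto_compose[OF u0 S_lim]) auto
  have u_0: "u 0 = u0 s"
    using LIMSEQ_unique[OF u_pt[of 0]] u0_lim b by (simp add: U_0)
  have "(\<lambda>k. l (U (r k) (S (r k)) b)) \<longlonglongrightarrow> l (u b)"
    by (rule continuous_on_tendsto_compose[OF l u_pt]) (use b in auto)
  then have u_b: "l (u b) = c" by (simp add: S_l LIMSEQ_const_iff)
  have u_eq: "u x = u0 s + integral {0..x} (\<lambda>t. F t (u t))" if x: "x \<in> {0..b}" for x
  proof -
    \<comment> \<open>The delay changes the argument of \<open>U\<close> by at most
      \<open>h (r k)\<close>, hence its value by at most \<open>C * h (r k)\<close>. So the delay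
      disappears in the limit, and the constant \<open>C\<close> dominates the integrands.\<close>
    have conv: "(\<lambda>k. F t (U (r k) (S (r k)) (max 0 (t - h (r k))))) \<longlonglongrightarrow> F t (u t)"
      if t: "t \<in> {0..x}" for t
    proof -
      have tb: "t \<in> {0..b}" using t x by auto
      have "(\<lambda>k. U (r k) (S (r k)) (max 0 (t - h (r k))) - U (r k) (S (r k)) t) \<longlonglongrightarrow> 0"
      proof (rule Lim_null_comparison[where g = "\<lambda>k. C * h (r k)"])
        show "\<forall>\<^sub>F k in sequentially.
            norm (U (r k) (S (r k)) (max 0 (t - h (r k))) - U (r k) (S (r k)) t) \<le> C * h (r k)"
        proof (rule always_eventually, rule allI)
          fix k
          have "norm (U (r k) (S (r k)) (max 0 (t - h (r k))) - U (r k) (S (r k)) t)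
              \<le> C * \<bar>max 0 (t - h (r k)) - t\<bar>"
            by (rule U_lip) (use tb h_pos[of "r k"] in auto)
          also have "\<dots> \<le> C * h (r k)"
            using tb h_pos[of "r k"] by (intro mult_left_mono[OF _ C]) auto
          finally show "norm (U (r k) (S (r k)) (max 0 (t - h (r k))) - U (r k) (S (r k)) t)
              \<le> C * h (r k)" .
        qed
        show "(\<lambda>k. C * h (r k)) \<longlonglongrightarrow> 0" using tendsto_mult_left[OF hr, of C] by simp
      qed
      from tendsto_add[OF this u_pt[OF tb]]
      have "(\<lambda>k. U (r k) (S (r k)) (max 0 (t - h (r k)))) \<longlonglongrightarrow> u t" by simp
      then have "(\<lambda>k. (t, U (r k) (S (r k)) (max 0 (t - h (r k))))) \<longlonglongrightarrow> (t, u t)"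
        by (intro tendsto_Pair) auto
      from continuous_on_tendsto_compose[OF F this] show ?thesis using tb by simp
    qed
    have "(\<lambda>k. integral {0..x} (\<lambda>t. F t (U (r k) (S (r k)) (max 0 (t - h (r k))))))
        \<longlonglongrightarrow> integral {0..x} (\<lambda>t. F t (u t))"
    proof (rule dominated_convergence(2)[where h = "\<lambda>_. C"])
      show "(\<lambda>t. F t (U (r k) (S (r k)) (max 0 (t - h (r k))))) integrable_on {0..x}" for k
        by (rule integrable_continuous_real)
          (use continuous_on_subset[OF G_cont, of "{0..x}"] x in auto)
    qed (use F_bound x conv in auto)
    from tendsto_add[OF u0_lim this]
    have "(\<lambda>k. U (r k) (S (r k)) x) \<longlonglongrightarrow> u0 s + integral {0..x} (\<lambda>t. F t (u t))"
      by (simp flip: U_eq[OF x])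
    then show ?thesis using LIMSEQ_unique u_pt[OF x] by blast
  qed
  have Fu: "continuous_on {0..b} (\<lambda>t. F t (u t))"
  proof -
    have "continuous_on {0..b} (\<lambda>t. (\<lambda>(t, u). F t u) (t, u t))"
      by (intro continuous_on_compose2[OF F] continuous_intros u_cont) auto
    then show ?thesis by simp
  qed
  have "(u has_vector_derivative F x (u x)) (at x within {0..b})" if x: "x \<in> {0..b}" for x
  proof -
    have "((\<lambda>x. u0 s + integral {0..x} (\<lambda>t. F t (u t))) has_vector_derivative F x (u x))
        (at x within {0..b})"
      using integral_has_vector_derivative[OF Fu x] by (auto intro!: derivative_eq_intros)
    then show ?thesis
      by (rule has_vector_derivative_transform[OF x, rotated]) (simp add: u_eq)
  qed
  then show ?thesis using that s u_0 u_b by blast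
qed

section \<open>Calculus on an interval\<close>

lemma DERIV_powr_const:
  fixes g :: "real \<Rightarrow> real"
  assumes "(g has_real_derivative d) (at x within S)" "0 < g x"
  shows "((\<lambda>x. g x powr r) has_real_derivative r * g x powr (r - 1) * d) (at x within S)"
  using DERIV_chain2[OF has_real_derivative_powr[OF assms(2)] assms(1)] .

lemma has_real_derivative_zero_of_superlinear:
  fixes g :: "real \<Rightarrow> real"
  assumes p: "p > 1" and le: "\<And>t. t \<in> S \<Longrightarrow> \<bar>g t - g x\<bar> \<le> C * \<bar>t - x\<bar> powr p"
  shows "(g has_real_derivative 0) (at x within S)"
proof -
  have "((\<lambda>t. C * \<bar>t - x\<bar> powr (p - 1)) \<longlongrightarrow> C * \<bar>x - x\<bar> powr (p - 1)) (at x within S)"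
    by (intro tendsto_intros) (use p in auto)
  then have lim: "((\<lambda>t. C * \<bar>t - x\<bar> powr (p - 1)) \<longlongrightarrow> 0) (at x within S)" by simp
  have "((\<lambda>t. (g t - g x) / (t - x)) \<longlongrightarrow> 0) (at x within S)"
  proof (rule Lim_null_comparison[OF _ lim])
    have "norm ((g t - g x) / (t - x)) \<le> C * \<bar>t - x\<bar> powr (p - 1)" if "t \<in> S" "t \<noteq> x" for t
      using le[OF that(1)] that(2) by (simp add: powr_diff field_simps)
    then show "\<forall>\<^sub>F t in at x within S. norm ((g t - g x) / (t - x)) \<le> C * \<bar>t - x\<bar> powr (p - 1)"
      by (auto simp: eventually_at_filter)
  qed
  then show ?thesis by (simp add: has_field_derivative_iff)
qed

text \<open>Continues a profile by zero beyond its interface. At \<open>x = b\<close> the derivative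
  from the left is that of \<open>g\<close>, and \<open>d = 0\<close> makes it match the derivative
  of the zero branch.\<close>

lemma has_real_derivative_extend_zero:
  fixes g :: "real \<Rightarrow> real"
  assumes x: "0 \<le> x" and b: "0 < b"
    and g: "x \<le> b \<Longrightarrow> (g has_real_derivative d) (at x within {0..b})"
    and gb: "g b = 0" and d: "b \<le> x \<Longrightarrow> d = 0"
  shows "((\<lambda>t. if t \<le> b then g t else 0) has_real_derivative d) (at x within {0..})"
proof -
  let ?g = "\<lambda>t. if t \<le> b then g t else 0"
  have left: "(?g has_real_derivative d) (at x within {0..b})" if "x \<le> b"
    by (rule has_field_derivative_transform_within[OF g[OF that], of 1]) (use x that in auto)
  have right: "(?g has_real_derivative d) (at x within {b..})" if "b \<le> x"
    by (rule has_field_derivative_transform_within[of "\<lambda>_. 0" d x "{b..}" 1])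
      (use that d[OF that] gb in auto)
  consider "x < b" | "x = b" | "b < x" by linarith
  then show ?thesis
  proof cases
    case 1
    have "at x within {0..} = at x within {0..b}"
      by (rule at_within_nhd[of x "{..<b}"]) (use 1 in auto)
    then show ?thesis using left 1 by simp
  next
    case 2
    have "{0..} = {0..b} \<union> {b..}" using b by auto
    moreover have "(?g has_real_derivative d) (at x within {0..b} \<union> {b..})"
      using left right 2 unfolding has_field_derivative_iff
      by (simp add: at_within_union filterlim_sup)
    ultimately show ?thesis by simp
  next
    case 3
    have "at x within {0..} = at x within {b..}"
      by (rule at_within_nhd[of x "{b<..}"]) (use 3 b in auto)
    then show ?thesis using right 3 by simp
  qed
qed

text \<open>At a positive maximum \<open>p\<close> the function \<open>H\<close> vanishes, either
  because \<open>p\<close> is interior or by \<open>H 0 = 0\<close>. To the right of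
  \<open>p\<close> it increases from zero as long as \<open>E\<close> is positive, so
  \<open>E\<close> would rise above its maximum. In the applications \<open>E\<close> compares two
  candidates for \<open>v^(n+1)\<close> and \<open>H\<close> is the difference of their
  fluxes.\<close>

lemma max_principle:
  fixes E H :: "real \<Rightarrow> real"
  assumes E: "continuous_on {0..b} E" and H: "continuous_on {0..b} H"
    and H0: "H 0 = 0" and Eb: "E b \<le> 0"
    and dE: "\<And>x. 0 < x \<Longrightarrow> x < b \<Longrightarrow> E x > 0 \<Longrightarrow> (E has_real_derivative H x) (at x)"
    and dH: "\<And>x. 0 < x \<Longrightarrow> x < b \<Longrightarrow> E x > 0 \<Longrightarrow> \<exists>d>0. (H has_real_derivative d) (at x)"
    and x: "x \<in> {0..b}"
  shows "E x \<le> 0"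
proof (rule ccontr)
  assume "\<not> E x \<le> 0"
  obtain p where p: "p \<in> {0..b}" and pmax: "\<And>t. t \<in> {0..b} \<Longrightarrow> E t \<le> E p"
    using continuous_attains_sup[OF _ _ E] x by fastforce
  have Ep: "E p > 0" using pmax[OF x] \<open>\<not> E x \<le> 0\<close> by linarith
  have pb: "p < b" using Ep Eb p by (cases "p = b") auto
  have Hp: "H p = 0"
  proof (cases "p = 0")
    case False
    then have p0: "0 < p" using p by auto
    show ?thesis
      by (rule DERIV_local_max[OF dE[OF p0 pb Ep], of "min p (b - p)"])
        (use p0 pb in \<open>auto intro!: pmax\<close>)
  qed (use H0 in simp)
  obtain d where d: "d > 0" "\<And>t. t \<in> {0..b} \<Longrightarrow> dist t p < d \<Longrightarrow> dist (E t) (E p) < E p"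
    using E p Ep unfolding continuous_on_iff by meson
  define q where "q = min b (p + d / 2)"
  have q: "p < q" "q \<le> b" using pb d by (auto simp: q_def)
  have Epos: "E t > 0" if "p \<le> t" "t < q" for t
  proof -
    have "dist (E t) (E p) < E p"
      by (rule d(2)) (use that p d(1) in \<open>auto simp: q_def dist_real_def\<close>)
    then show ?thesis by (simp add: dist_real_def abs_if split: if_splits)
  qed
  have sub: "{p..t} \<subseteq> {0..b}" if "t \<le> q" for t using that p q by auto
  have Hpos: "H t > 0" if t: "p < t" "t < q" for t
  proof -
    have "H p < H t"
    proof (rule DERIV_pos_imp_increasing_open[OF t(1)])
      fix r assume r: "p < r" "r < t"
      then show "\<exists>d. (H has_real_derivative d) (at r) \<and> d > 0"
        using dH[of r] Epos[of r] t p q by auto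
    qed (use continuous_on_subset[OF H sub[of t]] t in simp)
    then show ?thesis using Hp by simp
  qed
  have "E p < E q"
  proof (rule DERIV_pos_imp_increasing_open[OF q(1)])
    fix t assume t: "p < t" "t < q"
    then show "\<exists>y. (E has_real_derivative y) (at t) \<and> y > 0"
      using dE[of t] Epos[of t] Hpos[of t] p q by auto
  qed (rule continuous_on_subset[OF E sub], simp)
  then show False using pmax[of q] q p by auto
qed

section \<open>Sub- and supersolutions\<close>

text \<open>In terms of \<open>v = f^(m-1)\<close> and \<open>n = 1/(m-1)\<close> the left-hand side of the profile equation is
  \<open>v^(n-1)\<close> times this expression, with \<open>p = v'\<close> and \<open>q = v''\<close>.\<close>

definition residual :: "real \<Rightarrow> real \<Rightarrow> real \<Rightarrow> real \<Rightarrow> real \<Rightarrow> real \<Rightarrow> real \<Rightarrow> real \<Rightarrow> real"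
  where "residual n \<alpha> \<beta> \<sigma> x v p q =
    (n + 1) * v * q + n * (n + 1) * p\<^sup>2 - \<alpha> * v + \<beta> * n * x * p + x powr \<sigma>"

text \<open>The terms without \<open>residual\<close> are the flux law of an exact solution, so
  \<open>residual\<close> measures the defect: its sign decides whether the flux of a barrier grows
  faster or slower than that law prescribes.\<close>

lemma flux_derivative:
  fixes v v1 :: "real \<Rightarrow> real"
  assumes v: "(v has_real_derivative v1 x) (at x)" and v1: "(v1 has_real_derivative v2) (at x)"
    and pos: "0 < v x"
  shows "((\<lambda>x. (n + 1) * v x powr n * v1 x + \<beta> * x * v x powr n) has_real_derivative
    (\<alpha> + \<beta>) * v x powr n - x powr \<sigma> * v x powr (n - 1)
      + v x powr (n - 1) * residual n \<alpha> \<beta> \<sigma> x (v x) (v1 x) v2) (at x)"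
proof -
  let ?p = "v x powr (n - 1)"
  have vn: "v x powr n = v x * ?p" using pos by (simp add: powr_diff)
  have d: "((\<lambda>x. v x powr n) has_real_derivative n * ?p * v1 x) (at x)"
    by (rule DERIV_powr_const[OF v pos])
  have "((\<lambda>x. (n + 1) * v x powr n * v1 x + \<beta> * x * v x powr n) has_real_derivative
      (n + 1) * (n * ?p * v1 x) * v1 x + v2 * ((n + 1) * v x powr n)
      + (\<beta> * v x powr n + n * ?p * v1 x * (\<beta> * x))) (at x)"
    by (intro DERIV_add DERIV_mult DERIV_cmult d v1 DERIV_cmult_Id)
  then show ?thesis
    by (rule DERIV_cong) (simp add: vn residual_def algebra_simps power2_eq_square)
qed

text \<open>With \<open>y = v^(n+1)\<close> and flux \<open>z = y' + \<beta> x v^n\<close> the right-hand side contains no derivative, so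
  truncating \<open>v\<close> between \<open>lo\<close> and \<open>hi\<close> makes it bounded and continuous, even where \<open>v\<close>
  vanishes.\<close>

lemma sub_super_solution:
  fixes lo lo1 lo2 hi hi1 hi2 :: "real \<Rightarrow> real"
  assumes b: "0 < b" and n: "1 < n" and \<sigma>: "0 < \<sigma>"
    and cont: "continuous_on {0..b} lo" "continuous_on {0..b} lo1"
      "continuous_on {0..b} hi" "continuous_on {0..b} hi1"
    and lo_nonneg: "\<And>x. x \<in> {0..b} \<Longrightarrow> 0 \<le> lo x"
    and lo_hi: "\<And>x. x \<in> {0..b} \<Longrightarrow> lo x \<le> hi x"
    and lo_pos: "\<And>x. 0 < x \<Longrightarrow> x < b \<Longrightarrow> 0 < lo x"
    and neumann: "lo1 0 = 0" "hi1 0 = 0" and dirichlet: "hi b = 0"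
    and dlo: "\<And>x. 0 < x \<Longrightarrow> x < b \<Longrightarrow> (lo has_real_derivative lo1 x) (at x)"
    and dlo1: "\<And>x. 0 < x \<Longrightarrow> x < b \<Longrightarrow> (lo1 has_real_derivative lo2 x) (at x)"
    and dhi: "\<And>x. 0 < x \<Longrightarrow> x < b \<Longrightarrow> (hi has_real_derivative hi1 x) (at x)"
    and dhi1: "\<And>x. 0 < x \<Longrightarrow> x < b \<Longrightarrow> (hi1 has_real_derivative hi2 x) (at x)"
    and sub: "\<And>x. 0 < x \<Longrightarrow> x < b \<Longrightarrow> 0 < residual n \<alpha> \<beta> \<sigma> x (lo x) (lo1 x) (lo2 x)"
    and super: "\<And>x. 0 < x \<Longrightarrow> x < b \<Longrightarrow> residual n \<alpha> \<beta> \<sigma> x (hi x) (hi1 x) (hi2 x) < 0"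
  obtains y z where "z 0 = 0"
    "\<And>x. x \<in> {0..b} \<Longrightarrow> lo x powr (n + 1) \<le> y x"
    "\<And>x. x \<in> {0..b} \<Longrightarrow> y x \<le> hi x powr (n + 1)"
    "\<And>x. x \<in> {0..b} \<Longrightarrow>
      (y has_real_derivative z x - \<beta> * x * y x powr (n / (n + 1))) (at x within {0..b})"
    "\<And>x. x \<in> {0..b} \<Longrightarrow> (z has_real_derivative (\<alpha> + \<beta>) * y x powr (n / (n + 1))
      - x powr \<sigma> * y x powr ((n - 1) / (n + 1))) (at x within {0..b})"
proof -
  \<comment> \<open>The sign of \<open>y\<close> is unknown until the comparison is done, hence
    \<open>max 0 y\<close> under the power.\<close>
  define V where "V x y = max (lo x) (min (hi x) (max 0 y powr (1 / (n + 1))))" for x y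
  have V_nonneg: "0 \<le> V x y" if "x \<in> {0..b}" for x y
    using lo_nonneg[OF that] by (simp add: V_def)
  have V_le: "V x y \<le> hi x" if "x \<in> {0..b}" for x y
    using lo_hi[OF that] by (simp add: V_def)
  obtain K where K: "\<And>x. x \<in> {0..b} \<Longrightarrow> hi x \<le> K"
    using continuous_attains_sup[OF _ _ cont(3)] b
    by (metis atLeastatMost_empty_iff2 compact_Icc less_imp_le not_le)
  have K0: "0 \<le> K" using K[of 0] lo_nonneg[of 0] lo_hi[of 0] b by auto
  have V_powr: "\<bar>V x y powr r\<bar> \<le> K powr r" if "x \<in> {0..b}" "0 \<le> r" for x y r
    using V_nonneg[OF that(1), of y] V_le[OF that(1), of y] K[OF that(1)] that(2)
    by (auto intro: powr_mono2)
  define R where "R x y = (\<alpha> + \<beta>) * V x y powr n - x powr \<sigma> * V x y powr (n - 1)" for x y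
  define M where "M = \<bar>\<alpha> + \<beta>\<bar> * K powr n + b powr \<sigma> * K powr (n - 1)"
  have R_le: "\<bar>R x y\<bar> \<le> M" if x: "x \<in> {0..b}" for x y
  proof -
    have "\<bar>(\<alpha> + \<beta>) * V x y powr n\<bar> \<le> \<bar>\<alpha> + \<beta>\<bar> * K powr n"
      unfolding abs_mult by (intro mult_left_mono V_powr x) (use n in auto)
    moreover have "\<bar>x powr \<sigma> * V x y powr (n - 1)\<bar> \<le> b powr \<sigma> * K powr (n - 1)"
      unfolding abs_mult by (intro mult_mono V_powr x) (use n x \<sigma> in \<open>auto intro: powr_mono2\<close>)
    ultimately show ?thesis unfolding R_def M_def by linarith
  qed
  have M0: "0 \<le> M" by (simp add: M_def)
  \<comment> \<open>A flux that starts at zero with derivative bounded by \<open>M\<close> stays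
    within \<open>B\<close> on \<open>[0, b]\<close>. Clamping it to \<open>[-B, B]\<close>
    therefore makes \<open>F\<close> bounded without affecting the solution.\<close>
  define B where "B = M * b"
  have B0: "0 \<le> B" using M0 b by (simp add: B_def)
  define F where "F x u = (max (- B) (min B (snd u)) - \<beta> * x * V x (fst u) powr n, R x (fst u))"
    for x and u :: "real \<times> real"
  define C where "C = B + \<bar>\<beta>\<bar> * b * K powr n + M"
  have C0: "0 \<le> C" using B0 M0 b by (simp add: C_def)
  have F_le: "norm (F x u) \<le> C" if x: "x \<in> {0..b}" for x u
  proof -
    have "\<bar>\<beta> * x * V x (fst u) powr n\<bar> \<le> \<bar>\<beta>\<bar> * b * K powr n"
      unfolding abs_mult using x b n by (intro mult_mono V_powr x) auto
    moreover have "\<bar>max (- B) (min B (snd u))\<bar> \<le> B" using B0 by auto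
    ultimately have "\<bar>max (- B) (min B (snd u)) - \<beta> * x * V x (fst u) powr n\<bar> \<le> B + \<bar>\<beta>\<bar> * b * K powr n"
      by linarith
    then show ?thesis
      using norm_Pair_le[of "max (- B) (min B (snd u)) - \<beta> * x * V x (fst u) powr n" "R x (fst u)"]
        R_le[OF x, of "fst u"]
      by (simp add: F_def C_def)
  qed
  have F_cont: "continuous_on ({0..b} \<times> UNIV) (\<lambda>(t, u). F t u)"
  proof -
    have lo_c: "continuous_on ({0..b} \<times> UNIV) (\<lambda>w::real \<times> real \<times> real. lo (fst w))"
      by (rule continuous_on_compose2[OF cont(1)]) (auto intro!: continuous_intros)
    have hi_c: "continuous_on ({0..b} \<times> UNIV) (\<lambda>w::real \<times> real \<times> real. hi (fst w))"
      by (rule continuous_on_compose2[OF cont(3)]) (auto intro!: continuous_intros)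
    have V_c: "continuous_on ({0..b} \<times> UNIV) (\<lambda>w::real \<times> real \<times> real. V (fst w) (fst (snd w)))"
      unfolding V_def
      by (intro continuous_on_max continuous_on_min lo_c hi_c continuous_on_powr' continuous_intros)
        (use n in auto)
    have Vr: "continuous_on ({0..b} \<times> UNIV) (\<lambda>w::real \<times> real \<times> real. V (fst w) (fst (snd w)) powr r)"
      if "0 < r" for r
      by (intro continuous_on_powr' V_c continuous_intros) (use that V_nonneg in auto)
    have x\<sigma>: "continuous_on ({0..b} \<times> UNIV) (\<lambda>w::real \<times> real \<times> real. fst w powr \<sigma>)"
      by (intro continuous_on_powr' continuous_intros) (use \<sigma> in auto)
    have Vn: "continuous_on ({0..b} \<times> UNIV) (\<lambda>w::real \<times> real \<times> real. V (fst w) (fst (snd w)) powr n)"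
      and Vn1: "continuous_on ({0..b} \<times> UNIV) (\<lambda>w::real \<times> real \<times> real. V (fst w) (fst (snd w)) powr (n - 1))"
      using Vr n by simp_all
    have clamp: "continuous_on ({0..b} \<times> UNIV) (\<lambda>w::real \<times> real \<times> real. max (- B) (min B (snd (snd w))))"
      by (intro continuous_on_max continuous_on_min continuous_on_const continuous_on_snd continuous_on_id)
    show ?thesis
      unfolding F_def R_def case_prod_unfold
      by (intro continuous_on_Pair continuous_on_diff continuous_on_mult clamp Vn Vn1 x\<sigma>
          continuous_on_const continuous_on_fst continuous_on_id)
  qed
  \<comment> \<open>The initial flux is zero and the shooting parameter is the initial value of
    \<open>y\<close>, tuned to reach \<open>y b = 0\<close>. The range from \<open>- (C * b)\<close>
    to \<open>C * b\<close> suffices because the solution moves by at most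
    \<open>C * b\<close>.\<close>
  obtain s u where u0: "u 0 = (s, 0::real)" and ub: "fst (u b) = 0"
    and du: "\<And>x. x \<in> {0..b} \<Longrightarrow> (u has_vector_derivative F x (u x)) (at x within {0..b})"
  proof (rule peano_shooting[OF b F_cont F_le, where l = fst and c = 0 and ?u0.0 = "\<lambda>s. (s, 0)"
        and ?s1.0 = "- (C * b)" and ?s2.0 = "C * b"])
    show "fst ((- (C * b), 0) + w) \<le> 0" if "norm w \<le> C * b" for w :: "real \<times> real"
      using norm_fst_le[of "fst w" "snd w"] that by (simp add: abs_le_iff)
    show "0 \<le> fst ((C * b, 0) + w)" if "norm w \<le> C * b" for w :: "real \<times> real"
      using norm_fst_le[of "fst w" "snd w"] that by (simp add: abs_le_iff)
  qed (use C0 b in \<open>auto intro!: continuous_intros\<close>)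
  define y where "y x = fst (u x)" for x
  define z where "z x = snd (u x)" for x
  have dz: "(z has_real_derivative R x (y x)) (at x within {0..b})" if "x \<in> {0..b}" for x
    using bounded_linear.has_vector_derivative[OF bounded_linear_snd du[OF that]]
    by (simp add: F_def y_def z_def[abs_def] has_real_derivative_iff_has_vector_derivative)
  have z0: "z 0 = 0" by (simp add: z_def u0)
  have "\<bar>z x\<bar> \<le> B" if x: "x \<in> {0..b}" for x
  proof -
    have "norm (z x - z 0) \<le> M * norm (x - 0)"
      by (rule field_differentiable_bound[of "{0..b}", OF _ dz]) (use R_le x b in auto)
    also have "\<dots> \<le> B" unfolding B_def using x M0 by (auto intro: mult_left_mono)
    finally show ?thesis by (simp add: z0)
  qed
  then have clamp_z: "max (- B) (min B (z x)) = z x" if "x \<in> {0..b}" for x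
    using that by (fastforce simp: abs_le_iff)
  have dy: "(y has_real_derivative z x - \<beta> * x * V x (y x) powr n) (at x within {0..b})"
    if "x \<in> {0..b}" for x
    using bounded_linear.has_vector_derivative[OF bounded_linear_fst du[OF that]] clamp_z[OF that]
    by (simp add: F_def y_def[abs_def] z_def has_real_derivative_iff_has_vector_derivative)
  have yb: "y b = 0" by (simp add: y_def ub)
  have y_cont: "continuous_on {0..b} y"
    using dy by (meson DERIV_continuous continuous_on_eq_continuous_within)
  have z_cont: "continuous_on {0..b} z"
    using dz by (meson DERIV_continuous continuous_on_eq_continuous_within)
  have dy': "(y has_real_derivative z x - \<beta> * x * V x (y x) powr n) (at x)" if "0 < x" "x < b" for x
    using dy[of x] that by (simp add: at_within_Icc_at)
  have dz': "(z has_real_derivative R x (y x)) (at x)" if "0 < x" "x < b" for x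
    using dz[of x] that by (simp add: at_within_Icc_at)
  have hi_pos: "0 < hi x" if "0 < x" "x < b" for x using lo_pos[OF that] lo_hi[of x] that by simp
  have hi_nonneg: "0 \<le> hi x" if "x \<in> {0..b}" for x using lo_nonneg[OF that] lo_hi[OF that] by simp
  have flux_cont: "continuous_on {0..b} (\<lambda>x. (n + 1) * v x powr n * v1 x + \<beta> * x * v x powr n)"
    if "continuous_on {0..b} v" "continuous_on {0..b} v1" "\<And>x. x \<in> {0..b} \<Longrightarrow> 0 \<le> v x"
    for v v1 :: "real \<Rightarrow> real"
    by (intro continuous_intros continuous_on_powr' that) (use that n in auto)
  have powr_cont: "continuous_on {0..b} (\<lambda>x. v x powr (n + 1))"
    if "continuous_on {0..b} v" "\<And>x. x \<in> {0..b} \<Longrightarrow> 0 \<le> v x" for v :: "real \<Rightarrow> real"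
    by (intro continuous_intros continuous_on_powr' that) (use that n in auto)
  have lob: "lo b = 0" using lo_nonneg[of b] lo_hi[of b] dirichlet b by simp
  have le_hi: "y x \<le> hi x powr (n + 1)" if "x \<in> {0..b}" for x
  proof -
    let ?H = "\<lambda>x. z x - ((n + 1) * hi x powr n * hi1 x + \<beta> * x * hi x powr n)"
    \<comment> \<open>Above the supersolution the truncation returns exactly \<open>hi\<close>. The
      terms \<open>\<beta> * x * v^n\<close> then cancel, so the derivative of the difference is the
      difference of the fluxes, and the flux equations differ only by the residual.\<close>
    have V: "V x (y x) = hi x" if x: "0 < x" "x < b" "0 < y x - hi x powr (n + 1)" for x
    proof -
      have "hi x = (hi x powr (n + 1)) powr (1 / (n + 1))"
        using hi_pos[OF x(1,2)] n by (simp add: powr_powr)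
      also have "\<dots> \<le> max 0 (y x) powr (1 / (n + 1))" using x n by (intro powr_mono2) auto
      finally show ?thesis using lo_hi[of x] x by (simp add: V_def)
    qed
    have "y x - hi x powr (n + 1) \<le> 0"
    proof (rule max_principle[where b = b and H = ?H and E = "\<lambda>x. y x - hi x powr (n + 1)"])
      fix x assume x: "0 < x" "x < b" "0 < y x - hi x powr (n + 1)"
      show "((\<lambda>x. y x - hi x powr (n + 1)) has_real_derivative ?H x) (at x)"
        by (rule DERIV_cong[OF DERIV_diff[OF dy'[OF x(1,2)]
                DERIV_powr_const[OF dhi[OF x(1,2)] hi_pos[OF x(1,2)]]]])
          (simp add: V[OF x])
      have "(?H has_real_derivative
          - (hi x powr (n - 1) * residual n \<alpha> \<beta> \<sigma> x (hi x) (hi1 x) (hi2 x))) (at x)"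
        by (rule DERIV_cong[OF DERIV_diff[OF dz'[OF x(1,2)]
                flux_derivative[where \<alpha> = \<alpha> and \<sigma> = \<sigma>, OF dhi[OF x(1,2)] dhi1[OF x(1,2)] hi_pos[OF x(1,2)]]]])
          (simp add: V[OF x] R_def)
      moreover have "0 < - (hi x powr (n - 1) * residual n \<alpha> \<beta> \<sigma> x (hi x) (hi1 x) (hi2 x))"
        using hi_pos[OF x(1,2)] super[OF x(1,2)] by (simp add: mult_pos_neg)
      ultimately show "\<exists>d>0. (?H has_real_derivative d) (at x)" by blast
    qed (use that z0 yb neumann dirichlet n in
        \<open>auto intro!: continuous_on_diff y_cont z_cont flux_cont powr_cont cont hi_nonneg\<close>)
    then show ?thesis by simp
  qed
  have lo_le: "lo x powr (n + 1) \<le> y x" if "x \<in> {0..b}" for x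
  proof -
    let ?H = "\<lambda>x. ((n + 1) * lo x powr n * lo1 x + \<beta> * x * lo x powr n) - z x"
    have V: "V x (y x) = lo x" if x: "0 < x" "x < b" "0 < lo x powr (n + 1) - y x" for x
    proof -
      have "max 0 (y x) powr (1 / (n + 1)) \<le> (lo x powr (n + 1)) powr (1 / (n + 1))"
        using x n by (intro powr_mono2) auto
      also have "\<dots> = lo x" using lo_pos[OF x(1,2)] n by (simp add: powr_powr)
      finally show ?thesis by (simp add: V_def)
    qed
    have "lo x powr (n + 1) - y x \<le> 0"
    proof (rule max_principle[where b = b and H = ?H and E = "\<lambda>x. lo x powr (n + 1) - y x"])
      fix x assume x: "0 < x" "x < b" "0 < lo x powr (n + 1) - y x"
      show "((\<lambda>x. lo x powr (n + 1) - y x) has_real_derivative ?H x) (at x)"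
        by (rule DERIV_cong[OF DERIV_diff[OF
                DERIV_powr_const[OF dlo[OF x(1,2)] lo_pos[OF x(1,2)]] dy'[OF x(1,2)]]])
          (simp add: V[OF x])
      have "(?H has_real_derivative
          lo x powr (n - 1) * residual n \<alpha> \<beta> \<sigma> x (lo x) (lo1 x) (lo2 x)) (at x)"
        by (rule DERIV_cong[OF DERIV_diff[OF
                flux_derivative[where \<alpha> = \<alpha> and \<sigma> = \<sigma>, OF dlo[OF x(1,2)] dlo1[OF x(1,2)] lo_pos[OF x(1,2)]] dz'[OF x(1,2)]]])
          (simp add: V[OF x] R_def)
      moreover have "0 < lo x powr (n - 1) * residual n \<alpha> \<beta> \<sigma> x (lo x) (lo1 x) (lo2 x)"
        using lo_pos[OF x(1,2)] sub[OF x(1,2)] by simp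
      ultimately show "\<exists>d>0. (?H has_real_derivative d) (at x)" by blast
    qed (use that z0 yb neumann lob n in
        \<open>auto intro!: continuous_on_diff y_cont z_cont flux_cont powr_cont cont lo_nonneg\<close>)
    then show ?thesis by simp
  qed
  \<comment> \<open>The two comparisons show that the truncation is inactive along \<open>y\<close>,
    so \<open>y\<close> and \<open>z\<close> satisfy the original system.\<close>
  have V_y: "V x (y x) = y x powr (1 / (n + 1))" if x: "x \<in> {0..b}" for x
  proof -
    have y0: "0 \<le> y x" using lo_le[OF x] powr_ge_zero order_trans by blast
    have "lo x = (lo x powr (n + 1)) powr (1 / (n + 1))" using lo_nonneg[OF x] n by (simp add: powr_powr)
    also have "\<dots> \<le> y x powr (1 / (n + 1))" using lo_le[OF x] n by (intro powr_mono2) auto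
    finally have 1: "lo x \<le> y x powr (1 / (n + 1))" .
    have "y x powr (1 / (n + 1)) \<le> (hi x powr (n + 1)) powr (1 / (n + 1))"
      using le_hi[OF x] n y0 by (intro powr_mono2) auto
    also have "\<dots> = hi x" using hi_nonneg[OF x] n by (simp add: powr_powr)
    finally show ?thesis using 1 y0 by (simp add: V_def)
  qed
  show ?thesis
  proof (rule that[of z y])
    fix x assume x: "x \<in> {0..b}"
    show "(y has_real_derivative z x - \<beta> * x * y x powr (n / (n + 1))) (at x within {0..b})"
      using dy[OF x] by (simp add: V_y[OF x] powr_powr)
    show "(z has_real_derivative (\<alpha> + \<beta>) * y x powr (n / (n + 1))
        - x powr \<sigma> * y x powr ((n - 1) / (n + 1))) (at x within {0..b})"
      using dz[OF x] by (simp add: R_def V_y[OF x] powr_powr)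
  qed (fact z0 lo_le le_hi)+
qed

section \<open>Existence up to the critical interface point\<close>

text \<open>Here \<open>y\<close> is \<open>f^m\<close> and \<open>z\<close> is the flux \<open>(f^m)' + \<beta> \<xi> f\<close>. Since \<open>z\<close> is continuously
  differentiable up to the end points, the only delicate point is the differentiability of \<open>f\<close> where
  \<open>y\<close> vanishes: at \<open>b\<close> it comes from the assumed bound on \<open>y\<close>, at \<open>0\<close> from
  \<open>y = O(\<xi>\<^sup>2)\<close> and \<open>m < 2\<close>.\<close>

lemma good_profile_from_flux_system:
  fixes m \<sigma> b :: real and y z :: "real \<Rightarrow> real"
  assumes m: "1 < m" "m < 2" and \<sigma>: "2 < \<sigma>" and b: "0 < b"
    and y_pos: "\<And>x. 0 < x \<Longrightarrow> x < b \<Longrightarrow> 0 < y x" and y0: "0 \<le> y 0" and z0: "z 0 = 0"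
    and y_le: "\<And>x. x \<in> {0..b} \<Longrightarrow> y x \<le> C * (b - x) powr (m / (m - 1))" and yb: "y b = 0"
    and dy: "\<And>x. x \<in> {0..b} \<Longrightarrow>
      (y has_real_derivative z x - ss_beta \<sigma> * x * y x powr (1 / m)) (at x within {0..b})"
    and dz: "\<And>x. x \<in> {0..b} \<Longrightarrow>
      (z has_real_derivative (ss_alpha m \<sigma> + ss_beta \<sigma>) * y x powr (1 / m)
        - x powr \<sigma> * y x powr ((2 - m) / m)) (at x within {0..b})"
  defines "f \<equiv> \<lambda>x. if x \<le> b then y x powr (1 / m) else 0"
  shows "good_profile m \<sigma> f \<and> has_interface_at m f b"
proof -
  define \<alpha> where "\<alpha> = ss_alpha m \<sigma>"
  define \<beta> where "\<beta> = ss_beta \<sigma>"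
  have \<alpha>: "0 \<le> \<alpha>" and \<beta>: "0 \<le> \<beta>" using m \<sigma> by (auto simp: \<alpha>_def \<beta>_def ss_alpha_def ss_beta_def)
  note dy = dy[folded \<beta>_def] and dz = dz[folded \<alpha>_def \<beta>_def]
  let ?F = "\<lambda>x. y x powr (1 / m)"
  have y_nonneg: "0 \<le> y x" if "x \<in> {0..b}" for x
    using that y_pos[of x] y0 yb by (cases "x = 0 \<or> x = b") auto
  \<comment> \<open>The value 0 at the origin is right in both cases: for \<open>y 0 > 0\<close> the
    formula vanishes because \<open>z 0 = 0\<close>, and for \<open>y 0 = 0\<close> the quadratic
    bound below gives a zero derivative.\<close>
  define f1 where "f1 x = (if 0 < x \<and> x < b then (1 / m) * y x powr (1 / m - 1) * (z x - \<beta> * x * ?F x) else 0)" for x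
  define g1 where "g1 x = (if x \<le> b then z x - \<beta> * x * ?F x else 0)" for x
  \<comment> \<open>The profile equation is solved for the second derivative, so it holds by
    definition; what remains is that \<open>g2\<close> is the derivative of
    \<open>g1\<close>.\<close>
  define g2 where "g2 x = \<alpha> * f x - \<beta> * x * f1 x - x powr \<sigma> * f x powr (2 - m)" for x
  \<comment> \<open>The flux satisfies \<open>z' \<le> A\<close> and \<open>z 0 = 0\<close>, hence
    \<open>z x \<le> A * x\<close>; then \<open>y' \<le> z\<close> bounds \<open>y\<close>
    quadratically. The root of order \<open>m\<close> is \<open>O(x^(2/m))\<close>, which is
    superlinear since \<open>m < 2\<close>.\<close>
  have y_quadratic: "\<exists>A\<ge>0. \<forall>x\<in>{0..b}. y x \<le> A * x powr 2" if "y 0 = 0"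
  proof -
    have "continuous_on {0..b} y"
      using dy by (meson DERIV_continuous continuous_on_eq_continuous_within)
    then have "continuous_on {0..b} (\<lambda>x. (\<alpha> + \<beta>) * y x powr (1 / m))"
      by (intro continuous_intros continuous_on_powr') (use y_nonneg m in auto)
    then obtain p where "\<And>x. x \<in> {0..b} \<Longrightarrow> (\<alpha> + \<beta>) * y x powr (1 / m) \<le> (\<alpha> + \<beta>) * y p powr (1 / m)"
      using continuous_attains_sup[of "{0..b}" "\<lambda>x. (\<alpha> + \<beta>) * y x powr (1 / m)"] b
      by (metis atLeastatMost_empty_iff2 compact_Icc less_imp_le not_le)
    then obtain A where A: "A \<ge> 0" "\<And>x. x \<in> {0..b} \<Longrightarrow> (\<alpha> + \<beta>) * y x powr (1 / m) \<le> A"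
      using \<alpha> \<beta> by (meson add_nonneg_nonneg mult_nonneg_nonneg powr_ge_zero)
    have z_le: "z x \<le> A * x" if x: "x \<in> {0..b}" for x
    proof -
      have "(\<lambda>t. z t - A * t) x \<le> (\<lambda>t. z t - A * t) 0"
      proof (rule DERIV_nonpos_imp_decreasing_open[where f = "\<lambda>t. z t - A * t"])
        fix t assume t: "0 < t" "t < x"
        have "(z has_real_derivative (\<alpha> + \<beta>) * ?F t - t powr \<sigma> * y t powr ((2 - m) / m)) (at t)"
          using dz[of t] t x by (simp add: at_within_Icc_at)
        then have "((\<lambda>t. z t - A * t) has_real_derivative
            (\<alpha> + \<beta>) * ?F t - t powr \<sigma> * y t powr ((2 - m) / m) - A) (at t)"
          by (auto intro!: derivative_eq_intros)
        moreover have "(\<alpha> + \<beta>) * ?F t - t powr \<sigma> * y t powr ((2 - m) / m) - A \<le> 0"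
        proof -
          have "0 \<le> t powr \<sigma> * y t powr ((2 - m) / m)" by simp
          moreover have "(\<alpha> + \<beta>) * ?F t \<le> A" using A(2)[of t] t x by simp
          ultimately show ?thesis by linarith
        qed
        ultimately show "\<exists>d. ((\<lambda>t. z t - A * t) has_real_derivative d) (at t) \<and> d \<le> 0" by blast
      next
        have "continuous_on {0..b} z"
          using dz by (meson DERIV_continuous continuous_on_eq_continuous_within)
        then show "continuous_on {0..x} (\<lambda>t. z t - A * t)"
          by (intro continuous_intros) (use x in \<open>auto elim: continuous_on_subset\<close>)
      qed (use x in auto)
      then show ?thesis using z0 by simp
    qed
    have "y x \<le> A * x powr 2" if x: "x \<in> {0..b}" for x
    proof -
      have "(\<lambda>t. y t - A * t\<^sup>2) x \<le> (\<lambda>t. y t - A * t\<^sup>2) 0"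
      proof (rule DERIV_nonpos_imp_decreasing_open[where f = "\<lambda>t. y t - A * t\<^sup>2"])
        fix t assume t: "0 < t" "t < x"
        have "(y has_real_derivative z t - \<beta> * t * ?F t) (at t)"
          using dy[of t] t x by (simp add: at_within_Icc_at)
        then have "((\<lambda>t. y t - A * t\<^sup>2) has_real_derivative z t - \<beta> * t * ?F t - A * (2 * t)) (at t)"
          by (auto intro!: derivative_eq_intros)
        moreover have "z t - \<beta> * t * ?F t - A * (2 * t) \<le> 0"
        proof -
          have "0 \<le> \<beta> * t * ?F t" "0 \<le> A * t" using \<beta> A(1) t by auto
          then show ?thesis using z_le[of t] t x by auto
        qed
        ultimately show "\<exists>d. ((\<lambda>t. y t - A * t\<^sup>2) has_real_derivative d) (at t) \<and> d \<le> 0" by blast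
      next
        show "continuous_on {0..x} (\<lambda>t. y t - A * t\<^sup>2)"
          by (intro continuous_intros continuous_on_subset[OF \<open>continuous_on {0..b} y\<close>])
            (use x in auto)
      qed (use x in auto)
      then show ?thesis using that \<open>y 0 = 0\<close> by (simp add: powr_numeral)
    qed
    then show ?thesis using A(1) by blast
  qed
  have dF: "(?F has_real_derivative f1 x) (at x within {0..b})" if x: "x \<in> {0..b}" for x
  proof -
    have pos: "(?F has_real_derivative (1 / m) * y x powr (1 / m - 1) * (z x - \<beta> * x * ?F x))
        (at x within {0..b})" if "0 < y x"
      using dy[OF x] that by (auto intro!: derivative_eq_intros simp: field_simps)
    consider "0 < x" "x < b" | "x = b" | "x = 0" "y 0 > 0" | "x = 0" "y 0 = 0"
      using x y0 by fastforce
    then show ?thesis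
    proof cases
      case 1
      then show ?thesis using pos y_pos[of x] by (simp add: f1_def)
    next
      case 2
      have "(?F has_real_derivative 0) (at b within {0..b})"
      proof (rule has_real_derivative_zero_of_superlinear)
        show "1 / (m - 1) > 1" using m by simp
        fix t assume t: "t \<in> {0..b}"
        have "y t powr (1 / m) \<le> (\<bar>C\<bar> * (b - t) powr (m / (m - 1))) powr (1 / m)"
          by (intro powr_mono2 order_trans[OF y_le[OF t]] mult_right_mono)
            (use y_nonneg[OF t] m in auto)
        also have "\<dots> = \<bar>C\<bar> powr (1 / m) * (b - t) powr (1 / (m - 1))"
          using m t by (simp add: powr_mult powr_powr)
        finally show "\<bar>?F t - ?F b\<bar> \<le> \<bar>C\<bar> powr (1 / m) * \<bar>t - b\<bar> powr (1 / (m - 1))"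
          using yb t m by (simp add: abs_minus_commute)
      qed
      then show ?thesis using 2 by (simp add: f1_def)
    next
      case 3
      then show ?thesis using pos z0 by (simp add: f1_def)
    next
      case 4
      obtain A where A: "A \<ge> 0" "\<And>x. x \<in> {0..b} \<Longrightarrow> y x \<le> A * x powr 2"
        using y_quadratic[OF 4(2)] by blast
      have "(?F has_real_derivative 0) (at 0 within {0..b})"
      proof (rule has_real_derivative_zero_of_superlinear)
        show "2 / m > 1" using m by simp
        fix t assume t: "t \<in> {0..b}"
        have "y t powr (1 / m) \<le> (A * t powr 2) powr (1 / m)"
          using A(2)[OF t] y_nonneg[OF t] m by (intro powr_mono2) auto
        also have "\<dots> = A powr (1 / m) * t powr (2 / m)"
          using m t A(1) by (simp add: powr_mult powr_powr del: powr_numeral)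
        finally show "\<bar>?F t - ?F 0\<bar> \<le> A powr (1 / m) * \<bar>t - 0\<bar> powr (2 / m)"
          using 4(2) t m by simp
      qed
      then show ?thesis using 4 by (simp add: f1_def)
    qed
  qed
  have yb0: "(y has_real_derivative 0) (at b within {0..b})"
  proof (rule has_real_derivative_zero_of_superlinear)
    show "m / (m - 1) > 1" using m by simp
    fix t assume t: "t \<in> {0..b}"
    show "\<bar>y t - y b\<bar> \<le> C * \<bar>t - b\<bar> powr (m / (m - 1))"
      using y_le[OF t] y_nonneg[OF t] yb t by (simp add: abs_minus_commute)
  qed
  \<comment> \<open>The one-sided derivative of \<open>y\<close> at \<open>b\<close> is computed
    twice: it is \<open>z b\<close> by the system, as \<open>y b = 0\<close>, and it is 0 by the
    superlinear decay.\<close>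
  have zb: "z b = 0"
  proof -
    have "b \<in> {0..b}" using b by simp
    moreover have "at b within {0..b} \<noteq> bot" using b by (simp add: trivial_limit_within)
    ultimately have "z b - \<beta> * b * ?F b = 0"
      using has_field_derivative_unique[OF dy yb0] by blast
    then show ?thesis using yb by simp
  qed
  have df: "(f has_real_derivative f1 x) (at x within {0..})" if "0 \<le> x" for x
    unfolding f_def
    by (rule has_real_derivative_extend_zero[OF that b])
      (use dF[of x] that yb in \<open>auto simp: f1_def\<close>)
  have fm: "f x powr m = (if x \<le> b then y x else 0)" if "0 \<le> x" for x
    using that y_nonneg[of x] m by (auto simp: f_def powr_powr)
  have dfm: "((\<lambda>x. f x powr m) has_real_derivative g1 x) (at x within {0..})" if x: "0 \<le> x" for x
  proof -
    have "((\<lambda>x. if x \<le> b then y x else 0) has_real_derivative g1 x) (at x within {0..})"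
      by (rule has_real_derivative_extend_zero[OF x b])
        (use dy[of x] x yb zb in \<open>auto simp: g1_def\<close>)
    then show ?thesis
      by (rule has_field_derivative_transform_within[where d = 1]) (use fm x in auto)
  qed
  have f2m: "?F x powr (2 - m) = y x powr ((2 - m) / m)" for x
    using m by (simp add: powr_powr)
  \<comment> \<open>Up to \<open>b\<close>, \<open>g1\<close> is differentiable because
    \<open>z\<close> and the profile are. From \<open>b\<close> on, \<open>f\<close> and
    \<open>f1\<close> vanish and \<open>0 powr (2 - m) = 0\<close>, so \<open>g2\<close> vanishes as
    the gluing requires.\<close>
  have dg1: "(g1 has_real_derivative g2 x) (at x within {0..})" if x: "0 \<le> x" for x
    unfolding g1_def
  proof (rule has_real_derivative_extend_zero[OF x b])
    assume "x \<le> b"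
    then have xb: "x \<in> {0..b}" using x by simp
    show "((\<lambda>x. z x - \<beta> * x * ?F x) has_real_derivative g2 x) (at x within {0..b})"
      by (rule DERIV_cong[OF DERIV_diff[OF dz[OF xb] DERIV_mult'[OF DERIV_cmult_Id dF[OF xb]]]])
        (use xb in \<open>simp add: g2_def f_def f2m algebra_simps\<close>)
  qed (use yb zb m in \<open>auto simp: g2_def f_def f1_def\<close>)
  have "profile_solution m \<sigma> f"
    unfolding profile_solution_def
  proof (rule conjI, simp add: f_def, rule exI[of _ f1], rule exI[of _ g1], rule exI[of _ g2],
      intro allI impI conjI)
  qed ((rule df dfm dg1, assumption) | simp add: g2_def \<alpha>_def \<beta>_def)+
  moreover have "(f has_real_derivative 0) (at 0 within {0..})" using df[of 0] by (simp add: f1_def)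
  moreover have "((\<lambda>x. f x powr m) has_real_derivative 0) (at 0 within {0..})"
    using dfm[of 0] z0 b by (simp add: g1_def)
  moreover have "f 0 > 0 \<or> f 0 = 0" by (simp add: f_def)
  ultimately have "good_profile m \<sigma> f" by (auto simp: good_profile_def)
  moreover have "has_interface_at m f b"
    unfolding has_interface_at_def
  proof (intro conjI)
    have "at b within {0..} = at b" by (rule at_within_interior) (use b in \<open>simp add: interior_real_atLeast\<close>)
    then show "((\<lambda>x. f x powr m) has_real_derivative 0) (at b)"
      using dfm[of b] b yb zb by (simp add: g1_def)
    show "\<exists>\<delta>>0. \<forall>\<xi>\<in>{b - \<delta><..<b}. 0 < f \<xi>"
      by (rule exI[of _ b]) (use b y_pos in \<open>force simp: f_def\<close>)
  qed (use b yb m in \<open>auto simp: f_def\<close>)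
  ultimately show ?thesis by blast
qed

section \<open>Explicit barriers vanishing at the prescribed interface point\<close>

lemma xi_max_powr:
  assumes "1 < m" "2 < \<sigma>"
  shows "xi_max m \<sigma> powr (\<sigma> - 2) = (ss_beta \<sigma>)\<^sup>2 / (4 * m)"
  using assms by (simp add: xi_max_def powr_powr ss_beta_def)

text \<open>The slope \<open>- k * x\<close> minimizes \<open>n (n+1) w^2 + \<beta> n x w\<close>,
  with minimum \<open>- n (n+1) k^2 x^2\<close>. For \<open>x\<close> below \<open>xi_max\<close>
  this absorbs \<open>x powr \<sigma>\<close>, because
  \<open>xi_max powr (\<sigma> - 2) = n (n+1) k^2\<close>. The remaining terms are negative
  multiples of \<open>v\<close>.\<close>

lemma supersolution_residual:
  fixes m \<sigma> b x :: real
  assumes m: "1 < m" and \<sigma>: "2 < \<sigma>" and b: "b \<le> xi_max m \<sigma>" and x: "0 < x" "x < b"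
  defines "n \<equiv> 1 / (m - 1)"
  defines "k \<equiv> ss_beta \<sigma> / (2 * (n + 1))"
  shows "residual n (ss_alpha m \<sigma>) (ss_beta \<sigma>) \<sigma> x (k * (b\<^sup>2 - x\<^sup>2) / 2) (- k * x) (- k) < 0"
proof -
  define \<beta> where "\<beta> = ss_beta \<sigma>"
  define v where "v = k * (b\<^sup>2 - x\<^sup>2) / 2"
  have n: "0 < n" and mn: "m = (n + 1) / n" using m by (auto simp: n_def field_simps)
  have \<beta>: "0 < \<beta>" and \<alpha>: "0 < ss_alpha m \<sigma>" using m \<sigma> by (auto simp: \<beta>_def ss_beta_def ss_alpha_def)
  have k: "0 < k" and \<beta>k: "\<beta> = 2 * (n + 1) * k" using \<beta> n by (auto simp: k_def \<beta>_def)
  have v: "0 < v" using k x by (simp add: v_def power_strict_mono)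
  have "x powr \<sigma> = x\<^sup>2 * x powr (\<sigma> - 2)" using x by (simp add: powr_diff powr_numeral)
  also have "\<dots> \<le> x\<^sup>2 * xi_max m \<sigma> powr (\<sigma> - 2)"
    using x b \<sigma> by (intro mult_left_mono powr_mono2) auto
  also have "xi_max m \<sigma> powr (\<sigma> - 2) = n * (n + 1) * k\<^sup>2"
    unfolding xi_max_powr[OF m \<sigma>] \<beta>_def[symmetric] \<beta>k unfolding mn using n
    by (simp add: power_mult_distrib) (simp add: power2_eq_square field_simps)
  finally have x\<sigma>: "x powr \<sigma> \<le> x\<^sup>2 * (n * (n + 1) * k\<^sup>2)" .
  have "residual n (ss_alpha m \<sigma>) \<beta> \<sigma> x v (- k * x) (- k)
      = - ((n + 1) * k * v) - ss_alpha m \<sigma> * v + (x powr \<sigma> - x\<^sup>2 * (n * (n + 1) * k\<^sup>2))"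
    unfolding residual_def \<beta>k by (simp add: algebra_simps power2_eq_square)
  also have "\<dots> < 0"
  proof -
    have "0 < (n + 1) * k * v" "0 < ss_alpha m \<sigma> * v" using n k v \<alpha> by simp_all
    then show ?thesis using x\<sigma> by linarith
  qed
  finally show ?thesis by (simp add: v_def \<beta>_def)
qed

text \<open>The source term \<open>x powr \<sigma>\<close> dominates: every negative contribution is
  at most a multiple of \<open>\<theta> * x powr \<sigma>\<close>, and \<open>\<theta>_small\<close>
  limits their sum to half of it. The term \<open>- \<alpha> * v\<close> is compensated by
  differentiating \<open>x powr \<sigma>\<close> in the drift term, since \<open>\<alpha> = \<beta>
  n (\<sigma> + 2) / 2 \<le> \<beta> n \<sigma>\<close>.\<close>

lemma subsolution_residual:
  fixes m \<sigma> b x \<theta> :: real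
  assumes m: "1 < m" and \<sigma>: "2 < \<sigma>" and x: "0 < x" "x < b"
  defines "n \<equiv> 1 / (m - 1)"
  assumes \<theta>: "0 < \<theta>" "\<theta> \<le> 1"
    and \<theta>_small: "\<theta> * (ss_beta \<sigma> * n * b + 2 * (n + 1) * \<sigma> * b powr \<sigma>) \<le> 1 / 2"
  shows "0 < residual n (ss_alpha m \<sigma>) (ss_beta \<sigma>) \<sigma> x (\<theta> * x powr \<sigma> * (b - x))
    (\<theta> * (\<sigma> * x powr (\<sigma> - 1) * (b - x) - x powr \<sigma>))
    (\<theta> * (\<sigma> * (\<sigma> - 1) * x powr (\<sigma> - 2) * (b - x) - 2 * \<sigma> * x powr (\<sigma> - 1)))"
    (is "0 < residual n _ _ \<sigma> x ?v ?p ?q")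
proof -
  define \<alpha> where "\<alpha> = ss_alpha m \<sigma>"
  define \<beta> where "\<beta> = ss_beta \<sigma>"
  have n: "0 < n" using m by (simp add: n_def)
  have \<beta>: "0 < \<beta>" using \<sigma> by (simp add: \<beta>_def ss_beta_def)
  have "\<alpha> = \<beta> * n * ((\<sigma> + 2) / 2)"
    using m \<sigma> by (simp add: \<alpha>_def \<beta>_def n_def ss_alpha_def ss_beta_def divide_simps)
      (simp add: algebra_simps)
  also have "\<dots> \<le> \<beta> * n * \<sigma>" using \<beta> n \<sigma> by (intro mult_left_mono) auto
  finally have \<alpha>: "\<alpha> \<le> \<beta> * n * \<sigma>" .
  define X where "X = x powr \<sigma>"
  have X: "0 < X" and xX: "x * x powr (\<sigma> - 1) = X" using x by (simp_all add: X_def powr_diff)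
  \<comment> \<open>Only the second term of \<open>?q\<close> is negative. One of the two factors
    \<open>\<theta>\<close> is spent, with \<open>\<theta> \<le> 1\<close>, on keeping the bound
    linear in \<open>\<theta>\<close>.\<close>
  have "- (2 * \<sigma> * b powr \<sigma>) * \<theta> * X \<le> ?v * ?q"
  proof -
    have "x powr (\<sigma> - 1) * (b - x) \<le> b powr (\<sigma> - 1) * b"
      using x \<sigma> by (intro mult_mono powr_mono2) auto
    also have "\<dots> = b powr \<sigma>" using x by (simp add: powr_diff)
    finally have "\<theta> * (x powr (\<sigma> - 1) * (b - x)) \<le> 1 * b powr \<sigma>"
      using \<theta> x by (intro mult_mono) auto
    then have "2 * \<sigma> * \<theta> * X * (\<theta> * (x powr (\<sigma> - 1) * (b - x))) \<le> 2 * \<sigma> * \<theta> * X * (b powr \<sigma>)"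
      using \<sigma> \<theta> X by (intro mult_left_mono) auto
    moreover have "0 \<le> ?v * (\<theta> * (\<sigma> * (\<sigma> - 1) * x powr (\<sigma> - 2) * (b - x)))"
      using \<theta> \<sigma> x by simp
    moreover have "?v * ?q = ?v * (\<theta> * (\<sigma> * (\<sigma> - 1) * x powr (\<sigma> - 2) * (b - x)))
        - 2 * \<sigma> * \<theta> * X * (\<theta> * (x powr (\<sigma> - 1) * (b - x)))"
      by (simp add: X_def algebra_simps)
    ultimately show ?thesis by (simp add: algebra_simps)
  qed
  then have 1: "(n + 1) * (- (2 * \<sigma> * b powr \<sigma>) * \<theta> * X) \<le> (n + 1) * (?v * ?q)"
    using n by (intro mult_left_mono) auto
  have 2: "- (\<beta> * n * b) * \<theta> * X \<le> \<beta> * n * x * ?p - \<alpha> * ?v"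
  proof -
    have "\<beta> * n * x * ?p - \<alpha> * ?v
        = \<theta> * (\<beta> * n) * (\<sigma> * (x * x powr (\<sigma> - 1)) * (b - x) - x * X) - \<alpha> * (\<theta> * X * (b - x))"
      by (simp add: X_def algebra_simps)
    also have "\<dots> = \<theta> * X * ((\<beta> * n * \<sigma> - \<alpha>) * (b - x) - \<beta> * n * x)"
      unfolding xX by (simp add: algebra_simps)
    also have "\<dots> \<ge> \<theta> * X * (- (\<beta> * n * b))"
    proof (rule mult_left_mono)
      have "0 \<le> (\<beta> * n * \<sigma> - \<alpha>) * (b - x)" using \<alpha> x by simp
      moreover have "\<beta> * n * x \<le> \<beta> * n * b" using \<beta> n x by simp
      ultimately show "- (\<beta> * n * b) \<le> (\<beta> * n * \<sigma> - \<alpha>) * (b - x) - \<beta> * n * x" by linarith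
    qed (use \<theta> X in simp)
    finally show ?thesis by (simp add: algebra_simps)
  qed
  have "\<theta> * (\<beta> * n * b + 2 * (n + 1) * \<sigma> * b powr \<sigma>) * X \<le> 1 / 2 * X"
    using \<theta>_small X unfolding \<beta>_def by (intro mult_right_mono) auto
  then have 3: "- (\<beta> * n * b) * \<theta> * X + (n + 1) * (- (2 * \<sigma> * b powr \<sigma>) * \<theta> * X) \<ge> - (X / 2)"
    by (simp add: algebra_simps)
  have "residual n \<alpha> \<beta> \<sigma> x ?v ?p ?q
      = (n + 1) * (?v * ?q) + n * (n + 1) * ?p\<^sup>2 + (\<beta> * n * x * ?p - \<alpha> * ?v) + X"
    by (simp add: residual_def X_def mult.assoc)
  moreover have "0 \<le> n * (n + 1) * ?p\<^sup>2" using n by simp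
  ultimately have "0 < residual n \<alpha> \<beta> \<sigma> x ?v ?p ?q" using 1 2 3 X by linarith
  then show ?thesis by (simp add: \<alpha>_def \<beta>_def)
qed

lemma exists_good_profile_with_interface:
  fixes m \<sigma> b :: real
  assumes m: "1 < m" "m < 2" and \<sigma>: "2 < \<sigma>" and b: "0 < b" "b \<le> xi_max m \<sigma>"
  shows "\<exists>f. good_profile m \<sigma> f \<and> has_interface_at m f b"
proof -
  define n where "n = 1 / (m - 1)"
  define \<alpha> where "\<alpha> = ss_alpha m \<sigma>"
  define \<beta> where "\<beta> = ss_beta \<sigma>"
  define k where "k = \<beta> / (2 * (n + 1))"
  have n: "1 < n" using m by (simp add: n_def)
  have \<beta>: "0 < \<beta>" using \<sigma> by (simp add: \<beta>_def ss_beta_def)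
  have k: "0 < k" using \<beta> n by (simp add: k_def)
  define c where "c = \<beta> * n * b + 2 * (n + 1) * \<sigma> * b powr \<sigma>"
  have c: "0 < c" using \<beta> n b \<sigma> by (simp add: c_def add_pos_pos)
  \<comment> \<open>The bounds \<open>1\<close> and \<open>1 / 2 / c\<close> serve the subsolution
    inequality; the last one places the subsolution below the parabola.\<close>
  define \<theta> where "\<theta> = min 1 (min (1 / 2 / c) (k * b / 2 / b powr \<sigma>))"
  have \<theta>: "0 < \<theta>" "\<theta> \<le> 1" using c k b by (simp_all add: \<theta>_def)
  have \<theta>c: "\<theta> * c \<le> 1 / 2"
  proof -
    have "\<theta> \<le> 1 / 2 / c" by (simp add: \<theta>_def)
    then show ?thesis using c by (simp add: pos_le_divide_eq)
  qed
  have \<theta>k: "\<theta> * b powr \<sigma> \<le> k * b / 2"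
  proof -
    have "\<theta> \<le> k * b / 2 / b powr \<sigma>" by (simp add: \<theta>_def)
    then show ?thesis using b by (simp add: pos_le_divide_eq)
  qed
  let ?lo = "\<lambda>x. \<theta> * x powr \<sigma> * (b - x)"
  let ?lo1 = "\<lambda>x. \<theta> * (\<sigma> * x powr (\<sigma> - 1) * (b - x) - x powr \<sigma>)"
  let ?lo2 = "\<lambda>x. \<theta> * (\<sigma> * (\<sigma> - 1) * x powr (\<sigma> - 2) * (b - x) - 2 * \<sigma> * x powr (\<sigma> - 1))"
  let ?hi = "\<lambda>x. k * (b\<^sup>2 - x\<^sup>2) / 2"
  have hi_eq: "?hi x = (b - x) * (k * (b + x) / 2)" for x
    by (simp add: algebra_simps power2_eq_square)
  have dpow: "((\<lambda>x. x powr r) has_real_derivative r * x powr (r - 1)) (at x)" if "0 < x" for x r :: real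
    using has_real_derivative_powr[OF that] .
  have lo_hi: "?lo x \<le> ?hi x" if x: "x \<in> {0..b}" for x
  proof -
    have "\<theta> * x powr \<sigma> \<le> \<theta> * b powr \<sigma>" using x \<sigma> \<theta> by (intro mult_left_mono powr_mono2) auto
    also have "\<dots> \<le> k * b / 2" by (rule \<theta>k)
    also have "\<dots> \<le> k * (b + x) / 2" using k x by (intro divide_right_mono mult_left_mono) auto
    finally have "(b - x) * (\<theta> * x powr \<sigma>) \<le> (b - x) * (k * (b + x) / 2)"
      using x by (intro mult_left_mono) auto
    then show ?thesis unfolding hi_eq by (simp add: mult.commute)
  qed
  obtain y z where z0: "z 0 = 0"
    and lo_y: "\<And>x. x \<in> {0..b} \<Longrightarrow> ?lo x powr (n + 1) \<le> y x"
    and y_hi: "\<And>x. x \<in> {0..b} \<Longrightarrow> y x \<le> ?hi x powr (n + 1)"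
    and dy: "\<And>x. x \<in> {0..b} \<Longrightarrow>
      (y has_real_derivative z x - \<beta> * x * y x powr (n / (n + 1))) (at x within {0..b})"
    and dz: "\<And>x. x \<in> {0..b} \<Longrightarrow> (z has_real_derivative (\<alpha> + \<beta>) * y x powr (n / (n + 1))
      - x powr \<sigma> * y x powr ((n - 1) / (n + 1))) (at x within {0..b})"
  proof (rule sub_super_solution[of b n \<sigma> ?lo ?lo1 ?hi "\<lambda>x. - k * x" ?lo2 "\<lambda>x. - k" \<alpha> \<beta>])
    show "continuous_on {0..b} ?lo" "continuous_on {0..b} ?lo1"
      by (intro continuous_intros continuous_on_powr'; use \<sigma> in auto)+
    show "continuous_on {0..b} ?hi" "continuous_on {0..b} (\<lambda>x. - k * x)"
      by (intro continuous_intros; simp)+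
    fix x assume x: "0 < x" "x < b"
    show "(?lo has_real_derivative ?lo1 x) (at x)"
      using x by (auto intro!: derivative_eq_intros dpow simp: algebra_simps)
    show "(?lo1 has_real_derivative ?lo2 x) (at x)"
      using x by (auto intro!: derivative_eq_intros dpow simp: algebra_simps)
    show "(?hi has_real_derivative - k * x) (at x)" "((\<lambda>x. - k * x) has_real_derivative - k) (at x)"
      by (auto intro!: derivative_eq_intros)
    show "0 < residual n \<alpha> \<beta> \<sigma> x (?lo x) (?lo1 x) (?lo2 x)"
      using subsolution_residual[OF m(1) \<sigma> x \<theta>] \<theta>c by (simp add: n_def \<alpha>_def \<beta>_def c_def)
    show "residual n \<alpha> \<beta> \<sigma> x (?hi x) (- k * x) (- k) < 0"
      using supersolution_residual[OF m(1) \<sigma> b(2) x] by (simp add: n_def \<alpha>_def \<beta>_def k_def)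
  qed (use b n \<sigma> \<theta> lo_hi that in auto)
  have e1: "n / (n + 1) = 1 / m" and e2: "(n - 1) / (n + 1) = (2 - m) / m" and e3: "n + 1 = m / (m - 1)"
    using m by (simp_all add: n_def field_simps)
  have "good_profile m \<sigma> (\<lambda>x. if x \<le> b then y x powr (1 / m) else 0) \<and>
      has_interface_at m (\<lambda>x. if x \<le> b then y x powr (1 / m) else 0) b"
  proof (rule good_profile_from_flux_system[where z = z, OF m \<sigma> b(1)])
    show "0 < y x" if "0 < x" "x < b" for x
    proof -
      have "0 < ?lo x powr (n + 1)" using that \<theta> by simp
      also have "\<dots> \<le> y x" by (rule lo_y) (use that in simp)
      finally show ?thesis .
    qed
    show "0 \<le> y 0" using order_trans[OF powr_ge_zero lo_y[of 0]] b by simp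
    show "z 0 = 0" by (rule z0)
    show "y b = 0" using lo_y[of b] y_hi[of b] b by simp
    \<comment> \<open>The parabola vanishes linearly at \<open>b\<close>, so its power
      \<open>n + 1 = m / (m - 1)\<close> gives the decay that makes \<open>b\<close> an
      interface.\<close>
    show "y x \<le> (k * b) powr (m / (m - 1)) * (b - x) powr (m / (m - 1))" if x: "x \<in> {0..b}" for x
    proof -
      have "?hi x \<le> (k * b) * (b - x)"
      proof -
        have "(b - x) * (k * (b + x) / 2) \<le> (b - x) * (k * (b + b) / 2)"
          using x k by (intro mult_left_mono divide_right_mono) auto
        then show ?thesis unfolding hi_eq by (simp add: algebra_simps)
      qed
      then have "?hi x powr (n + 1) \<le> ((k * b) * (b - x)) powr (n + 1)"
        using x k n b unfolding hi_eq by (intro powr_mono2) auto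
      also have "\<dots> = (k * b) powr (n + 1) * (b - x) powr (n + 1)"
        using x k b by (simp add: powr_mult)
      finally show ?thesis using y_hi[OF x] by (simp add: e3)
    qed
  qed (use dy dz in \<open>simp_all add: e1 e2 \<alpha>_def \<beta>_def\<close>)
  then show ?thesis by blast
qed

section \<open>Nonexistence beyond the critical interface point\<close>

text \<open>The quadratic governing the slope \<open>w\<close> of \<open>f^(m-1)\<close> at an interface; its discriminant has the
  sign of \<open>xi_max - \<xi>\<close>.\<close>

lemma slope_quadratic_ge:
  fixes m \<sigma> \<xi> w :: real
  assumes m: "1 < m" and \<sigma>: "2 < \<sigma>" and \<xi>: "0 < \<xi>"
  defines "n \<equiv> 1 / (m - 1)"
  shows "n * (n + 1) * w\<^sup>2 + ss_beta \<sigma> * n * \<xi> * w + \<xi> powr \<sigma>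
    \<ge> \<xi>\<^sup>2 * (\<xi> powr (\<sigma> - 2) - xi_max m \<sigma> powr (\<sigma> - 2))"
proof -
  have n: "n > 0" "n + 1 \<noteq> 0" and mn: "m = (n + 1) / n" using m by (auto simp: n_def field_simps)
  have 1: "\<xi> powr \<sigma> = \<xi>\<^sup>2 * \<xi> powr (\<sigma> - 2)"
    using \<xi> by (simp add: powr_diff powr_numeral)
  define k where "k = ss_beta \<sigma> * \<xi> / (2 * (n + 1))"
  have k: "ss_beta \<sigma> * \<xi> = 2 * (n + 1) * k" using n by (simp add: k_def)
  have "\<xi>\<^sup>2 * ((ss_beta \<sigma>)\<^sup>2 / (4 * m)) = (ss_beta \<sigma> * \<xi>)\<^sup>2 * n / (4 * (n + 1))"
    using n unfolding mn by (simp add: field_simps)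
  also have "\<dots> = n * (n + 1) * k\<^sup>2"
    unfolding k using n
    by (subst nonzero_divide_eq_eq) (auto simp: algebra_simps power2_eq_square)
  finally have "n * (n + 1) * w\<^sup>2 + n * (ss_beta \<sigma> * \<xi>) * w + \<xi>\<^sup>2 * ((ss_beta \<sigma>)\<^sup>2 / (4 * m))
      = n * (n + 1) * (w + k)\<^sup>2"
    unfolding k by (simp add: algebra_simps power2_eq_square)
  moreover have "0 \<le> n * (n + 1) * (w + k)\<^sup>2" using n by simp
  ultimately show ?thesis unfolding 1 xi_max_powr[OF m \<sigma>] by (simp add: algebra_simps)
qed

lemma no_interface_beyond_xi_max:
  assumes m: "1 < m" "m < 2" and \<sigma>: "2 < \<sigma>" and b: "xi_max m \<sigma> < b"
    and sol: "profile_solution m \<sigma> f" and int: "has_interface_at m f b"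
  shows False
proof -
  define \<alpha> where "\<alpha> = ss_alpha m \<sigma>"
  define \<beta> where "\<beta> = ss_beta \<sigma>"
  define n where "n = 1 / (m - 1)"
  have \<alpha>: "0 < \<alpha>" and \<beta>: "0 < \<beta>" and n: "0 < n"
    using m \<sigma> by (auto simp: \<alpha>_def \<beta>_def n_def ss_alpha_def ss_beta_def)
  obtain f1 g1 g2 where
    df0: "\<And>x. 0 \<le> x \<Longrightarrow> (f has_real_derivative f1 x) (at x within {0..})" and
    dg0: "\<And>x. 0 \<le> x \<Longrightarrow> ((\<lambda>x. f x powr m) has_real_derivative g1 x) (at x within {0..})" and
    dg10: "\<And>x. 0 \<le> x \<Longrightarrow> (g1 has_real_derivative g2 x) (at x within {0..})" and
    eq: "\<And>x. 0 \<le> x \<Longrightarrow> g2 x - \<alpha> * f x + \<beta> * x * f1 x + x powr \<sigma> * f x powr (2 - m) = 0"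
    using sol unfolding profile_solution_def \<alpha>_def \<beta>_def by blast
  have at0: "at x within {0..} = at x" if "0 < x" for x :: real
    by (rule at_within_interior) (use that in simp)
  have df: "(f has_real_derivative f1 x) (at x)" if "0 < x" for x
    using df0[of x] that by (simp add: at0)
  have dg: "((\<lambda>x. f x powr m) has_real_derivative g1 x) (at x)" if "0 < x" for x
    using dg0[of x] that by (simp add: at0)
  have dg1: "(g1 has_real_derivative g2 x) (at x)" if "0 < x" for x
    using dg10[of x] that by (simp add: at0)
  obtain \<delta> where b0: "0 < b" and fb: "f b = 0"
    and gb: "((\<lambda>x. f x powr m) has_real_derivative 0) (at b)"
    and \<delta>: "0 < \<delta>" and f_pos: "\<And>x. b - \<delta> < x \<Longrightarrow> x < b \<Longrightarrow> 0 < f x"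
    using int unfolding has_interface_at_def by auto
  have g1b: "g1 b = 0" using DERIV_unique[OF dg[OF b0] gb] .
  have f2m: "f x powr (2 - m) = f x / f x powr (m - 1)" if "0 < f x" for x
    using that by (simp add: powr_diff power2_eq_square powr_numeral field_simps)
  \<comment> \<open>Half of the lower bound for the slope quadratic at \<open>b\<close>; the other
    half leaves room for \<open>\<alpha> * v\<close>, which tends to zero, and for the variation of
    \<open>x\<close>.\<close>
  define \<kappa> where "\<kappa> = b\<^sup>2 * (b powr (\<sigma> - 2) - xi_max m \<sigma> powr (\<sigma> - 2)) / 2"
  have xi0: "0 < xi_max m \<sigma>" using m \<sigma> by (simp add: xi_max_def ss_beta_def)
  have \<kappa>: "0 < \<kappa>"
    unfolding \<kappa>_def using b b0 \<sigma> xi0 by (auto intro!: mult_pos_pos powr_less_mono2)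
  have contf: "isCont f b" using df[OF b0] by (rule DERIV_isCont)
  define v where "v x = f x powr (m - 1)" for x
  have vb: "v b = 0" using m by (simp add: v_def fb)
  \<comment> \<open>The first smallness condition on \<open>v\<close> makes the flux decrease; the
    second makes \<open>v * v''\<close> negative, bounded away from zero.\<close>
  have "\<forall>\<^sub>F x in at_left b. 0 < x \<and> b - \<delta> < x \<and> x < b \<and> (\<alpha> + \<beta>) * v x < x powr \<sigma> \<and>
      \<alpha> * v x < x\<^sup>2 * (x powr (\<sigma> - 2) - xi_max m \<sigma> powr (\<sigma> - 2)) - \<kappa>"
  proof (intro eventually_conj)
    have f_lim: "(f \<longlongrightarrow> 0) (at_left b)"
      using contf fb by (auto simp: isCont_def intro: filterlim_at_split[THEN iffD1, THEN conjunct1])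
    have "(v \<longlongrightarrow> 0 powr (m - 1)) (at_left b)"
      unfolding v_def
    proof (rule tendsto_powr'[OF f_lim tendsto_const])
      have "\<forall>\<^sub>F x in at_left b. b - \<delta> < x \<and> x < b"
        using \<delta> by (intro eventually_conj eventually_at_left_real eventually_at_leftI[of "b - \<delta>"]) auto
      then show "0 \<noteq> (0::real) \<or> 0 < m - 1 \<and> (\<forall>\<^sub>F x in at_left b. 0 \<le> f x)"
        using m f_pos by (auto elim!: eventually_mono intro: less_imp_le)
    qed
    then have v_lim: "(v \<longlongrightarrow> 0) (at_left b)" by simp
    have id: "((\<lambda>x. x) \<longlongrightarrow> b) (at_left b)" by (rule tendsto_ident_at)
    show "\<forall>\<^sub>F x in at_left b. 0 < x" using order_tendstoD(1)[OF id b0] .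
    show "\<forall>\<^sub>F x in at_left b. b - \<delta> < x" using order_tendstoD(1)[OF id, of "b - \<delta>"] \<delta> by simp
    show "\<forall>\<^sub>F x in at_left b. x < b" by (simp add: eventually_at_filter)
    have "((\<lambda>x. x powr \<sigma> - (\<alpha> + \<beta>) * v x) \<longlongrightarrow> b powr \<sigma> - (\<alpha> + \<beta>) * 0) (at_left b)"
      by (intro tendsto_intros v_lim) (use b0 in auto)
    from order_tendstoD(1)[OF this, of 0] b0
    show "\<forall>\<^sub>F x in at_left b. (\<alpha> + \<beta>) * v x < x powr \<sigma>" by simp
    have "((\<lambda>x. x\<^sup>2 * (x powr (\<sigma> - 2) - xi_max m \<sigma> powr (\<sigma> - 2)) - \<alpha> * v x)
        \<longlongrightarrow> b\<^sup>2 * (b powr (\<sigma> - 2) - xi_max m \<sigma> powr (\<sigma> - 2)) - \<alpha> * 0) (at_left b)"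
      by (intro tendsto_intros v_lim) (use b0 in auto)
    from order_tendstoD(1)[OF this, of \<kappa>] \<kappa>
    have "\<forall>\<^sub>F x in at_left b. \<kappa> < x\<^sup>2 * (x powr (\<sigma> - 2) - xi_max m \<sigma> powr (\<sigma> - 2)) - \<alpha> * v x"
      by (simp add: \<kappa>_def)
    then show "\<forall>\<^sub>F x in at_left b. \<alpha> * v x < x\<^sup>2 * (x powr (\<sigma> - 2) - xi_max m \<sigma> powr (\<sigma> - 2)) - \<kappa>"
      by (rule eventually_mono) simp
  qed
  then obtain a where a: "a < b" and near: "\<And>x. a < x \<Longrightarrow> x < b \<Longrightarrow> 0 < x \<and> b - \<delta> < x \<and>
      (\<alpha> + \<beta>) * v x < x powr \<sigma> \<and> \<alpha> * v x < x\<^sup>2 * (x powr (\<sigma> - 2) - xi_max m \<sigma> powr (\<sigma> - 2)) - \<kappa>"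
    unfolding eventually_at_left_field by blast
  have pos: "0 < f x" "0 < v x" "0 < x" if "a < x" "x < b" for x
    using near[OF that] f_pos[of x] that by (auto simp: v_def)
  have flux_pos: "g1 x + \<beta> * x * f x > 0" if x: "a < x" "x < b" for x
  proof -
    have "(\<lambda>x. g1 x + \<beta> * x * f x) b < (\<lambda>x. g1 x + \<beta> * x * f x) x"
    proof (rule DERIV_neg_imp_decreasing_open[where f = "\<lambda>x. g1 x + \<beta> * x * f x", OF x(2)])
      fix t assume t: "x < t" "t < b"
      then have ta: "a < t" using x by simp
      note p = pos[OF ta t(2)]
      have "((\<lambda>x. g1 x + \<beta> * x * f x) has_real_derivative g2 t + (\<beta> * f t + \<beta> * t * f1 t)) (at t)"
        by (auto intro!: derivative_eq_intros dg1 df p)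
      \<comment> \<open>Since \<open>f^(2-m) = f / v\<close>, the flux derivative factors as
        \<open>f / v\<close> times
        \<open>(\<alpha> + \<beta>) * v - t powr \<sigma>\<close>.\<close>
      moreover have "g2 t + (\<beta> * f t + \<beta> * t * f1 t) < 0"
      proof -
        have "g2 t + (\<beta> * f t + \<beta> * t * f1 t) = (\<alpha> + \<beta>) * f t - t powr \<sigma> * f t powr (2 - m)"
          using eq[of t] p by (simp add: algebra_simps)
        also have "\<dots> = f t / v t * ((\<alpha> + \<beta>) * v t - t powr \<sigma>)"
          using p f2m[of t] by (simp add: v_def field_simps)
        also have "\<dots> < 0"
          using p near[OF ta t(2)] by (intro mult_pos_neg) auto
        finally show ?thesis .
      qed
      ultimately show "\<exists>y. ((\<lambda>x. g1 x + \<beta> * x * f x) has_real_derivative y) (at t) \<and> y < 0" by blast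
    next
      show "continuous_on {x..b} (\<lambda>x. g1 x + \<beta> * x * f x)"
        by (rule DERIV_atLeastAtMost_imp_continuous_on, rule exI)
          (use pos(3)[OF x] in \<open>auto intro!: derivative_eq_intros dg1 df\<close>)
    qed
    then show ?thesis by (simp add: g1b fb)
  qed
  \<comment> \<open>This is \<open>v'\<close>, because \<open>g1 = m f^(m-1) f'\<close>. Written
    through \<open>g1\<close> and \<open>f\<close> it can be differentiated again, whereas
    \<open>f1\<close> is not assumed differentiable.\<close>
  define v1 where "v1 x = (m - 1) / m * (g1 x / f x)" for x
  have dv: "(v has_real_derivative v1 x) (at x)" if x: "a < x" "x < b" for x
  proof -
    note p = pos[OF x]
    have "((\<lambda>x. f x powr m) has_real_derivative m * f x powr (m - 1) * f1 x) (at x)"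
      using DERIV_powr_const[OF df[OF p(3)] p(1)] .
    then have g1: "g1 x = m * f x powr (m - 1) * f1 x" using DERIV_unique[OF dg[OF p(3)]] by blast
    have "(v has_real_derivative (m - 1) * f x powr (m - 2) * f1 x) (at x)"
      using DERIV_powr_const[OF df[OF p(3)] p(1), of "m - 1"] unfolding v_def by simp
    moreover have "f x powr (m - 2) = f x powr (m - 1) / f x"
      using p by (simp add: powr_diff powr_numeral power2_eq_square)
    ultimately show ?thesis using m by (simp add: v1_def g1 mult.assoc)
  qed
  \<comment> \<open>Positivity of the flux reads \<open>g1 / f > - (\<beta> * x)\<close>, which
    bounds \<open>v'\<close> below by \<open>- L\<close>.\<close>
  define L where "L = (m - 1) / m * (\<beta> * b)"
  have L: "0 < L" using \<beta> b0 m by (simp add: L_def)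
  have v1_gt: "- L < v1 x" if x: "a < x" "x < b" for x
  proof -
    note p = pos[OF x]
    have "- (\<beta> * x) < g1 x / f x" using flux_pos[OF x] p by (simp add: field_simps)
    moreover have "- (\<beta> * b) < - (\<beta> * x)" using \<beta> x by simp
    ultimately have "- (\<beta> * b) < g1 x / f x" by linarith
    then have "(m - 1) / m * (- (\<beta> * b)) < (m - 1) / m * (g1 x / f x)"
      using m by (intro mult_strict_left_mono) auto
    then show ?thesis by (simp only: L_def v1_def mult_minus_right)
  qed
  have v_le: "v x \<le> L * (b - x)" if x: "a < x" "x < b" for x
  proof -
    have "(\<lambda>t. v t + L * t) x \<le> (\<lambda>t. v t + L * t) b"
    proof (rule DERIV_nonneg_imp_increasing_open[where f = "\<lambda>t. v t + L * t"])
      fix t assume t: "x < t" "t < b"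
      then have ta: "a < t" using x by simp
      have "((\<lambda>t. v t + L * t) has_real_derivative v1 t + L) (at t)"
        by (auto intro!: derivative_eq_intros dv ta t)
      then show "\<exists>y. ((\<lambda>t. v t + L * t) has_real_derivative y) (at t) \<and> 0 \<le> y"
        using v1_gt[OF ta t(2)] by (intro exI[of _ "v1 t + L"]) simp
    next
      have fx: "continuous_on {x..b} f"
        by (rule DERIV_atLeastAtMost_imp_continuous_on, rule exI) (use pos(3)[OF x] in \<open>auto intro!: df\<close>)
      have "0 \<le> f t" if "t \<in> {x..b}" for t
        using that x pos(1)[of t] fb by (cases "t = b") auto
      then show "continuous_on {x..b} (\<lambda>t. v t + L * t)"
        unfolding v_def using m by (intro continuous_intros continuous_on_powr' fx) auto
    qed (use x in auto)
    then show ?thesis by (simp add: vb algebra_simps)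
  qed
  define v2 where "v2 x = (m - 1) / m * ((g2 x * f x - g1 x * f1 x) / (f x)\<^sup>2)" for x
  have dv1: "(v1 has_real_derivative v2 x) (at x)" if x: "a < x" "x < b" for x
    unfolding v1_def v2_def using pos[OF x] m
    by (auto intro!: derivative_eq_intros dg1 df simp: power2_eq_square field_simps)
  \<comment> \<open>In terms of \<open>v\<close> the profile equation reads
    \<open>(n+1) v v'' = \<alpha> v\<close> minus the slope quadratic, so the left side is at most
    \<open>- \<kappa>\<close>. Dividing and using \<open>v \<le> L * (b - x)\<close> produces the
    singular bound.\<close>
  have v2_le: "v2 x \<le> - (\<kappa> / ((n + 1) * L)) / (b - x)" if x: "a < x" "x < b" for x
  proof -
    note p = pos[OF x]
    have mn: "m = (n + 1) / n" and m1: "m - 1 = 1 / n" using m by (auto simp: n_def field_simps)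
    have "((\<lambda>x. f x powr m) has_real_derivative m * f x powr (m - 1) * f1 x) (at x)"
      using DERIV_powr_const[OF df[OF p(3)] p(1)] .
    then have g1: "g1 x = m * v x * f1 x" unfolding v_def using DERIV_unique[OF dg[OF p(3)]] by blast
    have v1: "v1 x = (m - 1) * v x * f1 x / f x" using m by (simp add: v1_def g1)
    have f1: "f1 x = n * v1 x * f x / v x" unfolding v1 m1 using p n by simp
    have g1': "g1 x = (n + 1) * v1 x * f x" unfolding g1 f1 mn using p n by simp
    have g2: "g2 x = f x * (\<alpha> - (\<beta> * n * x * v1 x + x powr \<sigma>) / v x)"
      using eq[of x] p f2m[of x] by (simp add: f1 v_def field_simps)
    have "(g2 x * f x - g1 x * f1 x) / (f x)\<^sup>2
        = \<alpha> - (n * (n + 1) * (v1 x)\<^sup>2 + \<beta> * n * x * v1 x + x powr \<sigma>) / v x"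
      unfolding g2 g1' f1 using p by (simp add: field_simps power2_eq_square)
    moreover have "(m - 1) / m = 1 / (n + 1)" using m by (simp add: n_def field_simps)
    ultimately have "v2 x = 1 / (n + 1)
        * (\<alpha> - (n * (n + 1) * (v1 x)\<^sup>2 + \<beta> * n * x * v1 x + x powr \<sigma>) / v x)"
      unfolding v2_def by simp
    then have "(n + 1) * v x * v2 x
        = v x * (\<alpha> - (n * (n + 1) * (v1 x)\<^sup>2 + \<beta> * n * x * v1 x + x powr \<sigma>) / v x)"
      using n by simp
    also have "\<dots> = \<alpha> * v x - (n * (n + 1) * (v1 x)\<^sup>2 + \<beta> * n * x * v1 x + x powr \<sigma>)"
      using p by (simp add: right_diff_distrib)
    also have "\<dots> \<le> \<alpha> * v x - x\<^sup>2 * (x powr (\<sigma> - 2) - xi_max m \<sigma> powr (\<sigma> - 2))"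
      using slope_quadratic_ge[OF m(1) \<sigma> p(3), of "v1 x"] by (simp add: n_def \<beta>_def)
    also have "\<dots> \<le> - \<kappa>" using near[OF x] by simp
    finally have "v2 x * ((n + 1) * v x) \<le> - \<kappa>" by (simp add: mult.commute)
    moreover have nv: "0 < (n + 1) * v x" using p n by simp
    ultimately have "v2 x \<le> - \<kappa> / ((n + 1) * v x)" by (subst pos_le_divide_eq)
    moreover have "\<kappa> / ((n + 1) * (L * (b - x))) \<le> \<kappa> / ((n + 1) * v x)"
      using p n L \<kappa> x by (intro divide_left_mono mult_left_mono v_le mult_pos_pos) auto
    ultimately show ?thesis by (simp add: mult.assoc)
  qed
  define K where "K = \<kappa> / ((n + 1) * L)"
  have K: "0 < K" using \<kappa> n L by (simp add: K_def)
  define a' where "a' = (a + b) / 2"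
  have a': "a < a'" "a' < b" using a by (auto simp: a'_def)
  text \<open>Integrating \<open>v'' \<le> - K / (b - x)\<close> forces \<open>v'\<close> to \<open>-\<infinity>\<close>.\<close>
  have bound: "v1 x \<le> v1 a' - K * ln (b - a') + K * ln (b - x)" if x: "a' \<le> x" "x < b" for x
  proof -
    have "(\<lambda>t. v1 t - K * ln (b - t)) x \<le> (\<lambda>t. v1 t - K * ln (b - t)) a'"
    proof (rule DERIV_nonpos_imp_nonincreasing[where f = "\<lambda>t. v1 t - K * ln (b - t)", OF x(1)])
      fix t assume t: "a' \<le> t" "t \<le> x"
      then have tt: "a < t" "t < b" using a' x by auto
      have "((\<lambda>t. v1 t - K * ln (b - t)) has_real_derivative v2 t + K / (b - t)) (at t)"
        using tt by (auto intro!: derivative_eq_intros dv1)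
      then show "\<exists>y. ((\<lambda>t. v1 t - K * ln (b - t)) has_real_derivative y) (at t) \<and> y \<le> 0"
        using v2_le[OF tt] by (intro exI[of _ "v2 t + K / (b - t)"]) (simp add: K_def)
    qed
    then show ?thesis by simp
  qed
  \<comment> \<open>At \<open>ln (b - x) = e\<close> the upper bound for \<open>v1 x\<close> equals
    \<open>- L\<close>, which the strict lower bound excludes. The minimum in \<open>x\<close> keeps
    it in \<open>[a', b)\<close>.\<close>
  define e where "e = (- L - (v1 a' - K * ln (b - a'))) / K"
  define x where "x = b - min (b - a') (exp e)"
  have x: "a' \<le> x" "x < b" and bx: "0 < b - x" "b - x \<le> exp e" using a' by (auto simp: x_def)
  have "ln (b - x) \<le> e" using bx by (metis ln_exp ln_le_cancel_iff exp_gt_zero)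
  then have "K * ln (b - x) \<le> - L - (v1 a' - K * ln (b - a'))"
    using K by (simp add: e_def field_simps)
  then have "v1 x \<le> - L" using bound[OF x] by linarith
  then show False using v1_gt[of x] x a' by simp
qed

theorem theorem1p2:
  fixes m p \<sigma> :: real
  assumes "m > 1" and "0 < p" and "p < 1" and "m + p = 2" and "\<sigma> > 2"
  shows "xi_max m \<sigma> = (1 / (m * (\<sigma> - 2)\<^sup>2)) powr (1 / (\<sigma> - 2)) \<and>
         0 < xi_max m \<sigma> \<and>
         (\<forall>\<xi>0. 0 < \<xi>0 \<and> \<xi>0 \<le> xi_max m \<sigma> \<longrightarrow>
            (\<exists>f. good_profile m \<sigma> f \<and> has_interface_at m f \<xi>0)) \<and>
         (\<forall>\<xi>0. \<xi>0 > xi_max m \<sigma> \<longrightarrow>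
            \<not> (\<exists>f. good_profile m \<sigma> f \<and> has_interface_at m f \<xi>0))"
proof -
  have m: "1 < m" "m < 2" using assms by auto
  have "xi_max m \<sigma> = (1 / (m * (\<sigma> - 2)\<^sup>2)) powr (1 / (\<sigma> - 2))"
    by (simp add: xi_max_def ss_beta_def power_divide mult.commute)
  moreover have "0 < xi_max m \<sigma>" using assms by (simp add: xi_max_def ss_beta_def)
  ultimately show ?thesis
    using exists_good_profile_with_interface[OF m \<open>\<sigma> > 2\<close>]
      no_interface_beyond_xi_max[OF m \<open>\<sigma> > 2\<close>]
    unfolding good_profile_def by blast
qed

end
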